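(* For the Planck scale Hopf algebra $P=\mathbb{C}[x]\blacktriangleright\!\!\triangleleft_{\hbar,\mathsf{G}}\mathbb{C}[p]$ with its standard quantum differential calculus with right-invariant basis $\{\xi,\eta\}$, consider the bivector field $$\Pi=\big(\eta^*\otimes\xi^*-\Psi_{L,L}(\eta^*\otimes\xi^* )\big)\otimes\pi(g)$$ for an arbitrary function $\pi(g)$. Then the corresponding quantum Poisson bracket $\{a,b\}=\langle\Pi,\mathrm da\wedge\mathrm db\rangle$ is $$\{a,b\}=\pi(g)\Big(a_\xi b_\eta-a_\eta b_\xi+\imath A\big(a_\eta b_\eta+(a_\xi)_\eta b_\eta-(a_\eta)_\xi b_\eta\big)+(\imath A)^2(a_\eta)_\eta b_\eta\Big),$$ where $a_\xi=\partial_\xi a$, $a_\eta=\partial_\eta a$, etc. In particular, $\pi(g)=\frac1{\mathsf G}(g^{-1}-1)$ gives a deformation of the classical Poisson structure $\{a,b\}=(e^{-x/\mathsf G}-1)\big(\frac{\partial a}{\partial x}\frac{\partial b}{\partial p}-\frac{\partial b}{\partial x}\frac{\partial a}{\partial p}\big)$ on $C(B_+)$ (i.e. the bracket reduces to this one as $\hbar\to0$).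
   Context: $\hbar,\mathsf G$ are constants ($\mathsf G\ne0$), $A=\hbar/\mathsf G$, $\imath$ is the imaginary unit. $P$ (in algebraic form, $g=e^{-x/\mathsf G}$) is generated over $\mathbb C$ by $p,g,g^{-1}$ with $[p,g]=\imath A(1-g)g$, $\Delta p=p\otimes g+1\otimes p$, $\Delta g=g\otimes g$, $\epsilon(p)=0$, $\epsilon(g)=1$, $Sp=-pg^{-1}$, $Sg=g^{-1}$. At $\hbar=0$ it is the commutative Hopf algebra $C(B_+)=\mathbb C[p,g,g^{-1}]$; elements of $P$ are identified with functions $f(g,p)$ by normal ordering $:f(g,p):$ (all $g$ to the left of $p$), and $-\mathsf G\frac{\partial}{\partial x}=g\frac{\partial}{\partial g}$. The standard quantum exterior algebra $\Omega^\cdot$ on $P$ has a basis $\{\xi,\eta\}$ of right-invariant 1-forms with $\mathrm dg=g\xi$, $\mathrm dp=g\eta$, $[a,\xi]=0$, $[a,\eta]=\imath A\,\mathrm da$ for all $a\in P$, left coaction $\beta_L(\xi)=1\otimes\xi$, $\beta_L(\eta)=g^{-1}\otimes\eta+g^{-1}p\otimes\xi$, and $\xi\wedge\xi=0$, $\eta\wedge\xi=-\xi\wedge\eta$, $\eta\wedge\eta=\imath A\,\xi\wedge\eta$, $\mathrm d\xi=0$, $\mathrm d\eta=\eta\wedge\xi$. The derivatives $\partial_\xi,\partial_\eta:P\to P$ are defined by $\mathrm da=\xi\,\partial_\xi(a)+\eta\,\partial_\eta(a)$. Write $V=\mathrm{span}\{\xi,\eta\}$, a crossed module over $P$ (left module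 and comodule with $h_{(1)}v_{(1)}\otimes h_{(2)}\triangleright v_{(\infty)}=(h_{(1)}\triangleright v)_{(1)}h_{(2)}\otimes(h_{(1)}\triangleright v)_{(\infty)}$) with coaction $\beta_L(v)=v_{(1)}\otimes v_{(\infty)}$ and action $h\triangleright v=h_{(1)}vSh_{(2)}$, so that $\Omega^1=V\otimes P$ with $h\cdot(v\otimes f)=h_{(1)}\triangleright v\otimes h_{(2)}f$; crossed modules are braided by $\Psi_{V,W}(v\otimes w)=v_{(1)}\triangleright w\otimes v_{(\infty)}$. $L=V^*$ with dual basis $\{\xi^*,\eta^*\}$ is the dual crossed module (evaluation $L\otimes V\to\mathbb C$ being a morphism), and $\Psi_{L,L}$ is its braiding; with the pairing $\langle x\otimes y,v\otimes w\rangle=\langle y,v\rangle\langle x,w\rangle$ of $L\otimes L$ with $V\otimes V$ one has $\langle\Psi_{L,L}(x\otimes y),v\otimes w\rangle=\langle x\otimes y,\Psi_{V,V}(v\otimes w)\rangle$. Bivector fields are elements of $\Omega^{-2}=\{x\otimes y-\Psi_{L,L}(x\otimes y):x,y\in L\}\otimes P$, paired with 2-forms via $$\langle x\otimes y\otimes h,\ v\otimes w\otimes f\rangle=\langle y,h_{(1)}\triangleright v\rangle\,\langle x,h_{(2)}\triangleright w\rangle\,h_{(3)}f,$$ where the 2-form $v\wedge w\,f$ is represented by $v\otimes w\otimes f$ (well defined on $\Omega^2$, in which $V\otimes V$ is quotiented by $\ker(\mathrm{id}-\Psi_{V,V})$). Functions $\pi(g)$ are elements of $\mathbb C[g,g^{-1}]$.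 *)

theory Defs
  imports Complex_Main "HOL-Library.Poly_Mapping" "HOL-Library.Product_Plus"
begin

section \<open>Complex vector spaces with a chosen basis, and algebras\<close>

text \<open>
  \<open>'k \<Rightarrow>\<^sub>0 complex\<close> is the complex vector space with basis \<open>bas k\<close>; the tensor
  product of two such spaces is the one with the product basis.
\<close>

abbreviation bas :: "'k \<Rightarrow> 'k \<Rightarrow>\<^sub>0 complex" where
  "bas k \<equiv> Poly_Mapping.single k 1"

definition scale :: "complex \<Rightarrow> ('k \<Rightarrow>\<^sub>0 complex) \<Rightarrow> ('k \<Rightarrow>\<^sub>0 complex)" where
  "scale c f = Poly_Mapping.map ((*) c) f"

definition lin_ext :: "(complex \<Rightarrow> 'b \<Rightarrow> 'b::comm_monoid_add) \<Rightarrow> ('k \<Rightarrow> 'b) \<Rightarrow> ('k \<Rightarrow>\<^sub>0 complex) \<Rightarrow> 'b"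
  where "lin_ext s \<phi> f = (\<Sum>k\<in>Poly_Mapping.keys f. s (Poly_Mapping.lookup f k) (\<phi> k))"

definition tensor :: "('k \<Rightarrow>\<^sub>0 complex) \<Rightarrow> ('l \<Rightarrow>\<^sub>0 complex) \<Rightarrow> ('k \<times> 'l \<Rightarrow>\<^sub>0 complex)" where
  "tensor f h = lin_ext scale (\<lambda>k. lin_ext scale (\<lambda>l. bas (k, l)) h) f"

definition complex_algebra ::
  "(complex \<Rightarrow> 'b \<Rightarrow> 'b::ab_group_add) \<Rightarrow> ('b \<Rightarrow> 'b \<Rightarrow> 'b) \<Rightarrow> 'b \<Rightarrow> bool" where
  "complex_algebra s m e \<longleftrightarrow> vector_space s
     \<and> (\<forall>x. Vector_Spaces.linear s s (m x)) \<and> (\<forall>y. Vector_Spaces.linear s s (\<lambda>x. m x y))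
     \<and> (\<forall>x y z. m (m x y) z = m x (m y z)) \<and> (\<forall>x. m e x = x \<and> m x e = x)"

definition algebra_hom ::
  "(complex \<Rightarrow> 'a \<Rightarrow> 'a::ab_group_add) \<Rightarrow> ('a \<Rightarrow> 'a \<Rightarrow> 'a) \<Rightarrow> 'a \<Rightarrow>
   (complex \<Rightarrow> 'b \<Rightarrow> 'b::ab_group_add) \<Rightarrow> ('b \<Rightarrow> 'b \<Rightarrow> 'b) \<Rightarrow> 'b \<Rightarrow> ('a \<Rightarrow> 'b) \<Rightarrow> bool" where
  "algebra_hom s m e s' m' e' \<phi> \<longleftrightarrow> Vector_Spaces.linear s s' \<phi> \<and> \<phi> e = e'
     \<and> (\<forall>x y. \<phi> (m x y) = m' (\<phi> x) (\<phi> y))"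


section \<open>The Planck scale Hopf algebra\<close>

text \<open>
  The elements of \<open>P\<close> are identified with functions \<open>f(g,p)\<close> by normal ordering:
  the basis element with index \<open>(n, m)\<close> is \<open>g\<^sup>n p\<^sup>m\<close>, with \<open>g\<close> to the left of \<open>p\<close>.
  The vector space is thus independent of the parameter \<open>A = hbar/G\<close>; only the product depends on it.
  By \<open>planck_algebra\<close>, \<open>planck_relation\<close> and \<open>planck_universal\<close> the product \<open>mul A\<close> defined below
  is that of the algebra generated by \<open>p\<close>, \<open>g\<close>, \<open>g\<^sup>-\<^sup>1\<close> with \<open>[p,g] = \<ii>A(1-g)g\<close>.
\<close>

type_synonym fn = "int \<times> nat \<Rightarrow>\<^sub>0 complex"

definition mon :: "int \<Rightarrow> nat \<Rightarrow> fn" where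
  "mon n m = bas (n, m)"

abbreviation gP :: fn where "gP \<equiv> mon 1 0"
abbreviation gP_inv :: fn where "gP_inv \<equiv> mon (-1) 0"
abbreviation pP :: fn where "pP \<equiv> mon 0 1"

definition mul_g :: "int \<Rightarrow> fn \<Rightarrow> fn" where
  "mul_g k = lin_ext scale (\<lambda>(n, m). mon (k + n) m)"

text \<open>
  Left multiplication by \<open>p\<close>: the relation \<open>[p,g] = \<ii>A(1-g)g\<close> gives
  \<open>p g\<^sup>n = g\<^sup>n p + \<ii>A n (g\<^sup>n - g\<^sup>n\<^sup>+\<^sup>1)\<close>.
\<close>

definition mul_p :: "complex \<Rightarrow> fn \<Rightarrow> fn" where
  "mul_p A = lin_ext scale
     (\<lambda>(n, m). mon n (Suc m) + scale (\<i> * A * of_int n) (mon n m - mon (n + 1) m))"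

definition mul :: "complex \<Rightarrow> fn \<Rightarrow> fn \<Rightarrow> fn" where
  "mul A a b = lin_ext scale (\<lambda>(n, m). mul_g n ((mul_p A ^^ m) b)) a"

definition tensor_mul ::
  "complex \<Rightarrow> ((int \<times> nat) \<times> (int \<times> nat) \<Rightarrow>\<^sub>0 complex) \<Rightarrow>
   ((int \<times> nat) \<times> (int \<times> nat) \<Rightarrow>\<^sub>0 complex) \<Rightarrow> ((int \<times> nat) \<times> (int \<times> nat) \<Rightarrow>\<^sub>0 complex)" where
  "tensor_mul A s t = lin_ext scale (\<lambda>(i, j). lin_ext scale (\<lambda>(k, l).
     tensor (mul A (bas i) (bas k)) (mul A (bas j) (bas l))) t) s"

text \<open>
  The structure maps below, and later the differential, are given by \<open>THE\<close> from their defining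
  properties; \<open>coproduct_ex1\<close>, \<open>counit_ex1\<close>, \<open>antipode_ex1\<close> and \<open>calculus_ex1\<close>
  show unique existence.
\<close>

definition is_coproduct ::
  "complex \<Rightarrow> (fn \<Rightarrow> ((int \<times> nat) \<times> (int \<times> nat) \<Rightarrow>\<^sub>0 complex)) \<Rightarrow> bool" where
  "is_coproduct A D \<longleftrightarrow> algebra_hom scale (mul A) 1 scale (tensor_mul A) (tensor 1 1) D
     \<and> D pP = tensor pP gP + tensor 1 pP \<and> D gP = tensor gP gP"

definition coproduct :: "complex \<Rightarrow> fn \<Rightarrow> ((int \<times> nat) \<times> (int \<times> nat) \<Rightarrow>\<^sub>0 complex)" where
  "coproduct A = (THE D. is_coproduct A D)"

definition is_counit :: "complex \<Rightarrow> (fn \<Rightarrow> complex) \<Rightarrow> bool" where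
  "is_counit A e \<longleftrightarrow> algebra_hom scale (mul A) 1 (*) (*) 1 e \<and> e pP = 0 \<and> e gP = 1"

definition counit :: "complex \<Rightarrow> fn \<Rightarrow> complex" where
  "counit A = (THE e. is_counit A e)"

definition is_antipode :: "complex \<Rightarrow> (fn \<Rightarrow> fn) \<Rightarrow> bool" where
  "is_antipode A S \<longleftrightarrow> algebra_hom scale (mul A) 1 scale (\<lambda>x y. mul A y x) 1 S
     \<and> S pP = - mul A pP gP_inv \<and> S gP = gP_inv"

definition antipode :: "complex \<Rightarrow> fn \<Rightarrow> fn" where
  "antipode A = (THE S. is_antipode A S)"

text \<open>\<open>h\<^sub>1 \<otimes> h\<^sub>2 \<otimes> h\<^sub>3\<close>\<close>

definition coproduct2 ::
  "complex \<Rightarrow> fn \<Rightarrow> (((int \<times> nat) \<times> (int \<times> nat)) \<times> (int \<times> nat) \<Rightarrow>\<^sub>0 complex)" where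
  "coproduct2 A h =
     lin_ext scale (\<lambda>(i, j). tensor (coproduct A (bas i)) (bas j)) (coproduct A h)"


section \<open>The standard differential calculus\<close>

text \<open>
  \<open>Xi\<close>, \<open>Eta\<close> index the basis of \<open>V\<close> and the dual basis of \<open>L\<close>.  An element \<open>\<omega> :: form1\<close>
  of \<open>\<Omega>\<^sup>1 = V \<otimes> P\<close> is \<open>\<xi> (\<omega> Xi) + \<eta> (\<omega> Eta)\<close>, with coefficients on the right.
  In the same way \<open>\<tau> :: form2\<close> stands for the element
  \<open>\<Sum>\<^sub>k\<^sub>l v\<^sub>k \<otimes> v\<^sub>l \<otimes> \<tau> k l\<close> of \<open>V \<otimes> V \<otimes> P\<close>.
\<close>

datatype ix = Xi | Eta

type_synonym form1 = "ix \<Rightarrow> fn"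
type_synonym form2 = "ix \<Rightarrow> ix \<Rightarrow> fn"

definition basis_form :: "ix \<Rightarrow> form1" where
  "basis_form i = (\<lambda>j. if j = i then 1 else 0)"

text \<open>
  The left \<open>P\<close>-action on \<open>\<Omega>\<^sup>1\<close> dictated by \<open>a \<xi> = \<xi> a\<close> and \<open>a \<eta> = \<eta> a + \<ii>A da\<close>.
\<close>

definition left_mul :: "complex \<Rightarrow> (fn \<Rightarrow> form1) \<Rightarrow> fn \<Rightarrow> form1 \<Rightarrow> form1" where
  "left_mul A d a \<omega> = (\<lambda>i. mul A a (\<omega> i) + scale (\<i> * A) (mul A (d a i) (\<omega> Eta)))"

definition right_mul :: "complex \<Rightarrow> form1 \<Rightarrow> fn \<Rightarrow> form1" where
  "right_mul A \<omega> a = (\<lambda>i. mul A (\<omega> i) a)"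

definition is_standard_calculus :: "complex \<Rightarrow> (fn \<Rightarrow> form1) \<Rightarrow> bool" where
  "is_standard_calculus A d \<longleftrightarrow>
     (\<forall>i. Vector_Spaces.linear scale scale (\<lambda>a. d a i))
     \<and> (\<forall>a b. d (mul A a b) = (\<lambda>i. right_mul A (d a) b i + left_mul A d a (d b) i))
     \<and> d gP = left_mul A d gP (basis_form Xi)
     \<and> d pP = left_mul A d gP (basis_form Eta)"

definition dP :: "complex \<Rightarrow> fn \<Rightarrow> form1" where
  "dP A = (THE d. is_standard_calculus A d)"

abbreviation d_xi :: "complex \<Rightarrow> fn \<Rightarrow> fn" where "d_xi A a \<equiv> dP A a Xi"
abbreviation d_eta :: "complex \<Rightarrow> fn \<Rightarrow> fn" where "d_eta A a \<equiv> dP A a Eta"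


section \<open>The crossed modules \<open>V\<close> and \<open>L = V\<^sup>*\<close>\<close>

text \<open>
  \<open>h \<triangleright> v = h\<^sub>1 v S h\<^sub>2\<close>, an element of \<open>\<Omega>\<^sup>1\<close> which lies in \<open>V = V \<otimes> 1\<close>
  (\<open>actV_unique\<close>);
  \<open>actV A h i j\<close> is the coefficient of \<open>v\<^sub>j\<close> in \<open>h \<triangleright> v\<^sub>i\<close>.
\<close>

definition adjoint :: "complex \<Rightarrow> fn \<Rightarrow> ix \<Rightarrow> form1" where
  "adjoint A h i = (\<lambda>j. lin_ext scale (\<lambda>(k, l).
     right_mul A (left_mul A (dP A) (bas k) (basis_form i)) (antipode A (bas l)) j)
     (coproduct A h))"

definition actV :: "complex \<Rightarrow> fn \<Rightarrow> ix \<Rightarrow> ix \<Rightarrow> complex" where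
  "actV A h i j = (THE c. adjoint A h i j = scale c 1)"

text \<open>\<open>\<beta>\<^sub>L(v\<^sub>i) = \<Sum>\<^sub>j coactV A i j \<otimes> v\<^sub>j\<close>\<close>

definition coactV :: "complex \<Rightarrow> ix \<Rightarrow> ix \<Rightarrow> fn" where
  "coactV A i j = (case i of
      Xi \<Rightarrow> (case j of Xi \<Rightarrow> 1 | Eta \<Rightarrow> 0)
    | Eta \<Rightarrow> (case j of Xi \<Rightarrow> mul A gP_inv pP | Eta \<Rightarrow> gP_inv))"

text \<open>
  The dual crossed module: \<open>\<langle>h \<triangleright> x, v\<rangle> = \<langle>x, S h \<triangleright> v\<rangle>\<close> and
  \<open>x\<^sub>1 \<langle>x\<^sub>\<infinity>, v\<rangle> = S\<^sup>-\<^sup>1(v\<^sub>1) \<langle>x, v\<^sub>\<infinity>\<rangle>\<close>, which makes the evaluation \<open>L \<otimes> V \<rightarrow> \<complex>\<close>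
  a morphism (\<open>evaluation_module_morphism\<close>, \<open>evaluation_comodule_morphism\<close>).
  The index conventions are those of \<open>actV\<close> and \<open>coactV\<close>.
\<close>

definition actL :: "complex \<Rightarrow> fn \<Rightarrow> ix \<Rightarrow> ix \<Rightarrow> complex" where
  "actL A h i j = actV A (antipode A h) j i"

definition coactL :: "complex \<Rightarrow> ix \<Rightarrow> ix \<Rightarrow> fn" where
  "coactL A i j = inv (antipode A) (coactV A j i)"

text \<open>
  \<open>braidV A i j k l\<close> is the coefficient of \<open>v\<^sub>k \<otimes> v\<^sub>l\<close> in
  \<open>\<Psi>\<^sub>V\<^sub>,\<^sub>V(v\<^sub>i \<otimes> v\<^sub>j)\<close>, where \<open>\<Psi>(v \<otimes> w) = v\<^sub>1 \<triangleright> w \<otimes> v\<^sub>\<infinity>\<close>; similarly for \<open>braidL\<close>.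
\<close>

definition braidV :: "complex \<Rightarrow> ix \<Rightarrow> ix \<Rightarrow> ix \<Rightarrow> ix \<Rightarrow> complex" where
  "braidV A i j k l = actV A (coactV A i l) j k"

definition braidL :: "complex \<Rightarrow> ix \<Rightarrow> ix \<Rightarrow> ix \<Rightarrow> ix \<Rightarrow> complex" where
  "braidL A i j k l = actL A (coactL A i l) j k"


section \<open>Two-forms, bivector fields and the bracket\<close>

text \<open>\<open>ker(id - \<Psi>\<^sub>V\<^sub>,\<^sub>V) \<otimes> P\<close>, the subspace of \<open>V \<otimes> V \<otimes> P\<close> divided out in \<open>\<Omega>\<^sup>2\<close>.\<close>

definition sym_forms :: "complex \<Rightarrow> form2 set" where
  "sym_forms A = {\<tau>. \<forall>k l. \<tau> k l = (\<Sum>i\<in>UNIV. \<Sum>j\<in>UNIV. scale (braidV A i j k l) (\<tau> i j))}"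

text \<open>
  \<open>v\<^sub>i a \<otimes>\<^sub>P \<omega>' = v\<^sub>i \<otimes> a \<omega>'\<close> in \<open>\<Omega>\<^sup>1 \<otimes>\<^sub>P \<Omega>\<^sup>1 = V \<otimes> \<Omega>\<^sup>1 = V \<otimes> V \<otimes> P\<close>;
  the 2-form \<open>\<omega> \<and> \<omega>'\<close> is a coset of \<open>sym_forms A\<close>.
\<close>

definition tensor_forms :: "complex \<Rightarrow> form1 \<Rightarrow> form1 \<Rightarrow> form2" where
  "tensor_forms A \<omega> \<omega>' = (\<lambda>i j. left_mul A (dP A) (\<omega> i) \<omega>' j)"

definition wedge :: "complex \<Rightarrow> form1 \<Rightarrow> form1 \<Rightarrow> form2 set" where
  "wedge A \<omega> \<omega>' = {\<tau>. (\<lambda>i j. \<tau> i j - tensor_forms A \<omega> \<omega>' i j) \<in> sym_forms A}"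

text \<open>
  \<open>X :: bivec\<close> stands for \<open>\<Sum>\<^sub>i\<^sub>j e\<^sup>i \<otimes> e\<^sup>j \<otimes> X i j\<close> in \<open>L \<otimes> L \<otimes> P\<close>.  In
  \<open>\<langle>x \<otimes> y \<otimes> h, v \<otimes> w \<otimes> f\<rangle> = \<langle>y, h\<^sub>1 \<triangleright> v\<rangle> \<langle>x, h\<^sub>2 \<triangleright> w\<rangle> h\<^sub>3 f\<close> the inner factors
  are contracted first.
\<close>

type_synonym bivec = "ix \<Rightarrow> ix \<Rightarrow> fn"

definition pair_rep :: "complex \<Rightarrow> bivec \<Rightarrow> form2 \<Rightarrow> fn" where
  "pair_rep A X \<tau> = (\<Sum>i\<in>UNIV. \<Sum>j\<in>UNIV. \<Sum>k\<in>UNIV. \<Sum>l\<in>UNIV.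
     lin_ext scale (\<lambda>((h1, h2), h3).
       scale (actV A (bas h1) k j * actV A (bas h2) l i) (mul A (bas h3) (\<tau> k l)))
     (coproduct2 A (X i j)))"

text \<open>Independence of the representative \<open>\<tau>\<close> is shown in \<open>pairing_formula\<close>.\<close>

definition pairing :: "complex \<Rightarrow> bivec \<Rightarrow> form2 set \<Rightarrow> fn" where
  "pairing A X W = (THE r. \<forall>\<tau>\<in>W. pair_rep A X \<tau> = r)"

text \<open>
  \<open>bivector A T f\<close> is \<open>(T - \<Psi>\<^sub>L\<^sub>,\<^sub>L(T)) \<otimes> f\<close> for \<open>T = \<Sum>\<^sub>i\<^sub>j T i j e\<^sup>i \<otimes> e\<^sup>j\<close>.
\<close>

definition bivector :: "complex \<Rightarrow> (ix \<Rightarrow> ix \<Rightarrow> complex) \<Rightarrow> fn \<Rightarrow> bivec" where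
  "bivector A T f = (\<lambda>k l. scale (T k l - (\<Sum>i\<in>UNIV. \<Sum>j\<in>UNIV. T i j * braidL A i j k l)) f)"

definition eta_xi :: "ix \<Rightarrow> ix \<Rightarrow> complex" where
  "eta_xi i j = (if i = Eta \<and> j = Xi then 1 else 0)"

definition of_g :: "(int \<Rightarrow>\<^sub>0 complex) \<Rightarrow> fn" where
  "of_g = lin_ext scale (\<lambda>n. mon n 0)"

text \<open>\<open>(\<eta>\<^sup>* \<otimes> \<xi>\<^sup>* - \<Psi>\<^sub>L\<^sub>,\<^sub>L(\<eta>\<^sup>* \<otimes> \<xi>\<^sup>*)) \<otimes> \<pi>(g)\<close>\<close>

definition Pi_field :: "complex \<Rightarrow> (int \<Rightarrow>\<^sub>0 complex) \<Rightarrow> bivec" where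
  "Pi_field A \<pi> = bivector A eta_xi (of_g \<pi>)"

definition quantum_bracket :: "complex \<Rightarrow> bivec \<Rightarrow> fn \<Rightarrow> fn \<Rightarrow> fn" where
  "quantum_bracket A X a b = pairing A X (wedge A (dP A a) (dP A b))"


section \<open>The classical Poisson structure\<close>

text \<open>
  \<open>C(B\<^sub>+)\<close> is \<open>fn\<close> with its commutative product \<open>*\<close>.  Since \<open>g = e\<^sup>-\<^sup>x\<^sup>/\<^sup>G\<close>, the derivative
  \<open>\<partial>/\<partial>x\<close> multiplies \<open>g\<^sup>n\<close> by \<open>-n/G\<close>.
\<close>

definition dx :: "complex \<Rightarrow> fn \<Rightarrow> fn" where
  "dx G = lin_ext scale (\<lambda>(n, m). scale (- of_int n / G) (mon n m))"

definition dp :: "fn \<Rightarrow> fn" where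
  "dp = lin_ext scale (\<lambda>(n, m). scale (of_nat m) (mon n (m - 1)))"

definition classical_bracket :: "complex \<Rightarrow> fn \<Rightarrow> fn \<Rightarrow> fn" where
  "classical_bracket G a b = (gP - 1) * (dx G a * dp b - dx G b * dp a)"

text \<open>\<open>f\<close> as a function of \<open>x\<close> and \<open>p\<close>; see \<open>eval_classical_bracket\<close>.\<close>

definition eval_fn :: "complex \<Rightarrow> fn \<Rightarrow> complex \<Rightarrow> complex \<Rightarrow> complex" where
  "eval_fn G f x p = lin_ext (*) (\<lambda>(n, m). exp (- x / G) powi n * p ^ m) f"


section \<open>Well-definedness\<close>

subsection \<open>Linear maps and the algebra \<open>P\<close>\<close>

abbreviation "lin \<equiv> Vector_Spaces.linear"

lemma lookup_scale [simp]: "Poly_Mapping.lookup (scale c f) k = c * Poly_Mapping.lookup f k"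
  unfolding scale_def by transfer (simp add: when_def)

lemma vs_scale: "vector_space scale"
  by unfold_locales (auto intro!: poly_mapping_eqI simp: lookup_add algebra_simps)

interpretation sc: vector_space scale by (rule vs_scale)

lemma linI:
  assumes "vector_space s" "vector_space s'" "\<And>x y. \<phi> (x + y) = \<phi> x + \<phi> y" "\<And>c x. \<phi> (s c x) = s' c (\<phi> x)"
  shows "lin s s' \<phi>"
  using assms by (auto simp: Vector_Spaces.linear_iff)

lemma sc_linI:
  assumes "\<And>x y. \<phi> (x + y) = \<phi> x + \<phi> y" "\<And>c x. \<phi> (scale c x) = scale c (\<phi> x)"
  shows "lin scale scale \<phi>"
  using assms by (intro linI vs_scale)

lemma linD:
  assumes "lin s s' \<phi>"
  shows "\<phi> (x + y) = \<phi> x + \<phi> y" "\<phi> (s c x) = s' c (\<phi> x)" "\<phi> 0 = 0" "\<phi> (- x) = - \<phi> x"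
    "\<phi> (x - y) = \<phi> x - \<phi> y" "\<phi> (sum f I) = (\<Sum>i\<in>I. \<phi> (f i))"
proof -
  interpret l: Vector_Spaces.linear s s' \<phi> by fact
  show "\<phi> (x + y) = \<phi> x + \<phi> y" "\<phi> (s c x) = s' c (\<phi> x)" "\<phi> 0 = 0" "\<phi> (- x) = - \<phi> x"
    "\<phi> (x - y) = \<phi> x - \<phi> y" "\<phi> (sum f I) = (\<Sum>i\<in>I. \<phi> (f i))"
    by (simp_all add: l.add l.scale l.zero l.neg l.diff l.sum)
qed

lemma lin_vs: "lin s s' \<phi> \<Longrightarrow> vector_space s" "lin s s' \<phi> \<Longrightarrow> vector_space s'"
  by (auto simp: Vector_Spaces.linear_iff)

lemma lin_ext_superset:
  assumes "vector_space s" "finite K" "Poly_Mapping.keys f \<subseteq> K"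
  shows "lin_ext s \<phi> f = (\<Sum>k\<in>K. s (Poly_Mapping.lookup f k) (\<phi> k))"
proof -
  interpret vector_space s by fact
  show ?thesis unfolding lin_ext_def
    by (rule sum.mono_neutral_left) (use assms in \<open>auto simp: in_keys_iff\<close>)
qed

lemma lin_lin_ext:
  fixes \<phi> :: "'k \<Rightarrow> 'b::ab_group_add"
  assumes "vector_space s" shows "lin scale s (lin_ext s \<phi>)"
proof (rule linI[OF vs_scale assms])
  interpret vector_space s by fact
  fix x y :: "'k \<Rightarrow>\<^sub>0 complex" and c
  let ?K = "Poly_Mapping.keys x \<union> Poly_Mapping.keys y"
  have *: "lin_ext s \<phi> z = (\<Sum>k\<in>?K. s (Poly_Mapping.lookup z k) (\<phi> k))"
    if "Poly_Mapping.keys z \<subseteq> ?K" for z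
    by (rule lin_ext_superset) (use that assms in auto)
  show "lin_ext s \<phi> (x + y) = lin_ext s \<phi> x + lin_ext s \<phi> y"
    by (simp add: * Poly_Mapping.keys_add lookup_add scale_left_distrib sum.distrib)
  have "Poly_Mapping.keys (scale c x) \<subseteq> Poly_Mapping.keys x"
    by (auto simp: in_keys_iff)
  hence "lin_ext s \<phi> (scale c x) = (\<Sum>k\<in>Poly_Mapping.keys x. s (Poly_Mapping.lookup (scale c x) k) (\<phi> k))"
    by (intro lin_ext_superset assms) auto
  also have "\<dots> = s c (lin_ext s \<phi> x)"
    by (simp add: lin_ext_def scale_sum_right)
  finally show "lin_ext s \<phi> (scale c x) = s c (lin_ext s \<phi> x)" .
qed

lemma lin_ext_bas:
  assumes "vector_space s" shows "lin_ext s \<phi> (bas k) = \<phi> k"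
proof -
  interpret vector_space s by fact
  show ?thesis by (simp add: lin_ext_def)
qed

lemma single_scale: "Poly_Mapping.single k c = scale c (bas k)"
  by (rule poly_mapping_eqI) (simp add: lookup_single when_def)

lemma poly_mapping_sum_bas: "(\<Sum>k\<in>Poly_Mapping.keys f. scale (Poly_Mapping.lookup f k) (bas k)) = f"
  by (rule poly_mapping_eqI)
    (auto simp: lookup_sum lookup_single when_def in_keys_iff if_distrib[where f="(*) _"] cong: if_cong)

lemma lin_expand:
  assumes "lin scale s \<phi>"
  shows "\<phi> f = (\<Sum>k\<in>Poly_Mapping.keys f. s (Poly_Mapping.lookup f k) (\<phi> (bas k)))"
  by (subst (1) poly_mapping_sum_bas[of f, symmetric]) (simp add: linD[OF assms])

lemma lin_eqI:
  assumes "lin scale s \<phi>" "lin scale s \<psi>" "\<And>k. \<phi> (bas k) = \<psi> (bas k)"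
  shows "\<phi> x = \<psi> x"
  unfolding lin_expand[OF assms(1), of x] lin_expand[OF assms(2), of x] assms(3) ..

lemma lin_comp: "lin s s' \<phi> \<Longrightarrow> lin s' s'' \<psi> \<Longrightarrow> lin s s'' (\<lambda>x. \<psi> (\<phi> x))"
  by (auto simp: Vector_Spaces.linear_iff)

lemma lin_add: "lin s s' \<phi> \<Longrightarrow> lin s s' \<psi> \<Longrightarrow> lin s s' (\<lambda>x. \<phi> x + \<psi> x)"
  by (auto simp: Vector_Spaces.linear_iff vector_space_def algebra_simps)

lemma lin_diff: "lin s s' \<phi> \<Longrightarrow> lin s s' \<psi> \<Longrightarrow> lin s s' (\<lambda>x. \<phi> x - \<psi> x)"
proof (rule linI)
  assume l: "lin s s' \<phi>" "lin s s' \<psi>"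
  then interpret vector_space s' by (intro lin_vs(2))
  show "\<phi> (s c x) - \<psi> (s c x) = s' c (\<phi> x - \<psi> x)" for c x
    using l by (simp add: linD scale_right_diff_distrib)
qed (auto simp: linD lin_vs)

lemma lin_scale: "lin s scale \<phi> \<Longrightarrow> lin s scale (\<lambda>x. scale c (\<phi> x))"
  by (auto simp: Vector_Spaces.linear_iff sc.scale_right_distrib mult.commute)

lemma lin_id: "lin scale scale (\<lambda>x. x)" by (intro sc_linI) auto

lemma lin_ext_lin:
  assumes "\<And>k. lin s s' (\<lambda>y. \<phi> y k)"
  shows "lin s s' (\<lambda>y. lin_ext s' (\<phi> y) x)"
proof -
  interpret a: vector_space s' by (rule lin_vs(2)[OF assms])
  show ?thesis
    using lin_vs(1)[OF assms]
    by (intro linI) (auto simp: lin_ext_def linD[OF assms] a.scale_right_distrib sum.distrib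
      a.scale_sum_right mult.commute a.vector_space_axioms)
qed

lemma lin_power: "lin scale scale (f :: ('k \<Rightarrow>\<^sub>0 complex) \<Rightarrow> ('k \<Rightarrow>\<^sub>0 complex)) \<Longrightarrow> lin scale scale (f ^^ n)"
proof (induction n)
  case 0
  have "f ^^ 0 = (\<lambda>x. x)" by auto
  thus ?case using lin_id by metis
next
  case (Suc n)
  show ?case using lin_comp[OF Suc.IH[OF Suc.prems] Suc.prems] by (simp add: o_def)
qed

lemma lin_mul_g: "lin scale scale (mul_g k)"
  unfolding mul_g_def by (rule lin_lin_ext[OF vs_scale])
lemma lin_mul_p: "lin scale scale (mul_p A)"
  unfolding mul_p_def by (rule lin_lin_ext[OF vs_scale])

lemma bas_mon: "bas k = mon (fst k) (snd k)" by (simp add: mon_def)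

lemma mul_g_mon [simp]: "mul_g k (mon n m) = mon (k + n) m"
  by (simp add: mul_g_def mon_def lin_ext_bas vs_scale)
lemma mul_p_mon: "mul_p A (mon n m) = mon n (Suc m) + scale (\<i> * A * of_int n) (mon n m - mon (n + 1) m)"
  by (subst mon_def) (simp add: mul_p_def lin_ext_bas vs_scale)

lemma lin_mul_left: "lin scale scale (\<lambda>a. mul A a b)"
  unfolding mul_def by (rule lin_lin_ext[OF vs_scale])

lemma mul_mon: "mul A (mon n m) b = mul_g n ((mul_p A ^^ m) b)"
  by (simp add: mul_def mon_def lin_ext_bas vs_scale)

lemma lin_mul_right: "lin scale scale (mul A a)"
  unfolding mul_def
  by (rule lin_ext_lin) (auto simp: case_prod_unfold intro!: lin_comp[OF _ lin_mul_g] lin_power lin_mul_p)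

lemmas lin_simps = linD[OF lin_mul_g] linD[OF lin_mul_p] linD[OF lin_mul_left] linD[OF lin_mul_right]

lemma lin_eq_monI:
  assumes "lin scale s \<phi>" "lin scale s \<psi>" "\<And>n m. \<phi> (mon n m) = \<psi> (mon n m)"
  shows "\<phi> x = \<psi> x"
  by (rule lin_eqI[OF assms(1,2)]) (simp add: bas_mon assms(3))

lemma mul_g_mul_g [simp]: "mul_g k (mul_g l x) = mul_g (k + l) x"
  by (rule lin_eq_monI[OF lin_comp[OF lin_mul_g lin_mul_g] lin_mul_g]) (simp add: add.assoc)

lemma mul_g_0 [simp]: "mul_g 0 x = x"
  by (rule lin_eq_monI[OF lin_mul_g lin_id]) simp

lemma mul_p_mul_g: "mul_p A (mul_g n x) = mul_g n (mul_p A x) + scale (\<i> * A * of_int n) (mul_g n x - mul_g (n + 1) x)"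
  by (rule lin_eq_monI[OF lin_comp[OF lin_mul_g lin_mul_p] lin_add[OF lin_comp[OF lin_mul_p lin_mul_g] lin_scale[OF lin_diff[OF lin_mul_g lin_mul_g]]]])
     (simp add: mul_p_mon lin_simps sc.scale_right_diff_distrib sc.scale_left_distrib algebra_simps)

lemma mul_mul_g: "mul A (mul_g k a) b = mul_g k (mul A a b)"
  by (rule lin_eq_monI[OF lin_comp[OF lin_mul_g lin_mul_left] lin_comp[OF lin_mul_left lin_mul_g]])
     (simp add: mul_mon)

lemma mul_mul_p: "mul A (mul_p A a) b = mul_p A (mul A a b)"
  by (rule lin_eq_monI[OF lin_comp[OF lin_mul_p lin_mul_left] lin_comp[OF lin_mul_left lin_mul_p]])
     (simp add: mul_mon mul_p_mon lin_simps mul_p_mul_g)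

lemma mul_assoc: "mul A (mul A a b) c = mul A a (mul A b c)"
proof (rule lin_eq_monI[OF lin_comp[OF lin_mul_left lin_mul_left] lin_mul_left])
  fix n m
  have "mul A ((mul_p A ^^ m) b) c = (mul_p A ^^ m) (mul A b c)"
    by (induction m) (simp_all add: mul_mul_p)
  thus "mul A (mul A (mon n m) b) c = mul A (mon n m) (mul A b c)"
    by (simp add: mul_mon mul_mul_g)
qed

lemma one_mon: "(1::fn) = mon 0 0" 
  unfolding mon_def by (metis single_one zero_prod_def)

lemma mul_1_left [simp]: "mul A 1 a = a" by (simp add: one_mon mul_mon)

lemma mul_p_pow_1: "(mul_p A ^^ m) 1 = mon 0 m"
  by (induction m) (simp_all add: one_mon mul_p_mon)

lemma mul_1_right [simp]: "mul A a 1 = a"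
  by (rule lin_eq_monI[OF lin_mul_left lin_id]) (simp add: mul_mon mul_p_pow_1)

lemma planck_algebra: "complex_algebra scale (mul A) 1"
  unfolding complex_algebra_def using vs_scale lin_mul_left lin_mul_right mul_assoc by auto

lemma mul_mon_g: "mul A (mon n 0) b = mul_g n b" by (simp add: mul_mon)
lemma mul_pP: "mul A pP b = mul_p A b" by (simp add: mul_mon)

lemma normal_order: "mul A (mon n 0) (mon 0 m) = mon n m"
  by (simp add: mul_mon_g)
lemma g_relations: "mul A (mon n 0) (mon k 0) = mon (n + k) 0" "mul A gP gP_inv = 1" "mul A gP_inv gP = 1"
  by (simp_all add: mul_mon_g one_mon)
lemma p_powers: "mul A pP (mon 0 m) = mon 0 (Suc m)"
  by (simp add: mul_mon mul_p_mon)
lemma planck_relation: "mul A pP gP - mul A gP pP = scale (\<i> * A) (mul A (1 - gP) gP)"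
  by (simp add: mul_mon mul_p_mon lin_simps)

subsection \<open>The presentation of \<open>P\<close>\<close>

lemma algebra_homD:
  assumes "algebra_hom s m e s' m' e' \<phi>"
  shows "lin s s' \<phi>" "\<phi> e = e'" "\<phi> (m x y) = m' (\<phi> x) (\<phi> y)"
  using assms by (auto simp: algebra_hom_def)

lemma complex_algebraD:
  assumes "complex_algebra s m e"
  shows "vector_space s" "lin s s (m x)" "lin s s (\<lambda>x. m x y)" "m (m x y) z = m x (m y z)" "m e x = x" "m x e = x"
  using assms by (auto simp: complex_algebra_def)

lemma planck_hom_unique:
  assumes alg: "complex_algebra s m e"
    and \<phi>: "algebra_hom scale (mul A) 1 s m e \<phi>" and \<psi>: "algebra_hom scale (mul A) 1 s m e \<psi>"
    and eq: "\<phi> gP = \<psi> gP" "\<phi> pP = \<psi> pP"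
  shows "\<phi> = \<psi>"
proof
  fix x
  note assoc = complex_algebraD(4)[OF alg]
  note unit = complex_algebraD(5,6)[OF alg]
  note hom = algebra_homD[OF \<phi>] algebra_homD[OF \<psi>]
  have "m (\<phi> gP_inv) (\<phi> gP) = e" "m (\<psi> gP) (\<psi> gP_inv) = e"
    using hom(2,5) by (simp_all add: hom(3,6)[symmetric] g_relations(2,3))
  hence inv: "\<phi> gP_inv = \<psi> gP_inv"
    using assoc[of "\<phi> gP_inv" "\<psi> gP" "\<psi> gP_inv"] eq unit by simp
  have 1: "\<phi> (mon n 0) = \<psi> (mon n 0)" for n
  proof (induction n rule: int_induct[where k=0])
    case base show ?case using hom(2,5) by (simp add: one_mon)
  next
    case (step1 i)
    thus ?case using hom(3,6)[of gP "mon i 0"] eq by (simp add: g_relations add.commute)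
  next
    case (step2 i)
    thus ?case using hom(3,6)[of gP_inv "mon i 0"] inv by (simp add: g_relations)
  qed
  have 2: "\<phi> (mon 0 k) = \<psi> (mon 0 k)" for k
  proof (induction k)
    case 0 show ?case using hom(2,5) by (simp add: one_mon)
  next
    case (Suc k)
    thus ?case using hom(3,6)[of pP "mon 0 k"] eq unfolding p_powers by metis
  qed
  show "\<phi> x = \<psi> x"
    by (rule lin_eq_monI[OF hom(1,4)])
       (metis 1 2 hom(3,6) normal_order)
qed

lemma planck_universal:
  fixes s :: "complex \<Rightarrow> 'b \<Rightarrow> 'b::ab_group_add"
  assumes alg: "complex_algebra s m e"
    and rel: "m Q Q' = e" "m Q' Q = e" "m R Q - m Q R = s (\<i> * A) (m (e - Q) Q)"
  shows "\<exists>!\<phi>. algebra_hom scale (mul A) 1 s m e \<phi> \<and> \<phi> gP = Q \<and> \<phi> pP = R"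
proof -
  interpret V: vector_space s by (rule complex_algebraD(1)[OF alg])
  note assoc = complex_algebraD(4)[OF alg]
  note unit = complex_algebraD(5,6)[OF alg]
  note ml = linD[OF complex_algebraD(2)[OF alg]] linD[OF complex_algebraD(3)[OF alg]]
  define zp where "zp n = (if n \<ge> 0 then (m Q ^^ nat n) e else (m Q' ^^ nat (- n)) e)" for n :: int
  have z0: "zp 0 = e" by (simp add: zp_def)
  have QQ': "m Q (m Q' x) = x" "m Q' (m Q x) = x" for x
    using rel(1,2) unit by (simp_all add: assoc[symmetric])
  have zQ: "m Q (zp n) = zp (n + 1)" for n
  proof (cases "n \<ge> 0")
    case True
    hence "nat (n + 1) = Suc (nat n)" by simp
    thus ?thesis using True by (simp add: zp_def)
  next
    case False
    hence "nat (- n) = Suc (nat (- (n + 1)))" by simp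
    thus ?thesis using False by (cases "n = -1") (simp_all add: zp_def QQ')
  qed
  have zQ': "m Q' (zp n) = zp (n - 1)" for n
    using zQ[of "n - 1"] QQ'(2)[of "zp (n - 1)"] by simp
  have zz: "m (zp n) (zp k) = zp (n + k)" for n k
  proof (induction n rule: int_induct[where k=0])
    case base show ?case by (simp add: z0 unit)
  next
    case (step1 i)
    have "m (zp (i + 1)) (zp k) = m Q (m (zp i) (zp k))" by (simp add: zQ[symmetric] assoc)
    thus ?case by (simp add: step1.IH zQ algebra_simps)
  next
    case (step2 i)
    have "m (zp (i - 1)) (zp k) = m Q' (m (zp i) (zp k))" by (simp add: zQ'[symmetric] assoc)
    thus ?case by (simp add: step2.IH zQ' algebra_simps)
  qed
  have RQ: "m R Q = m Q R + s (\<i> * A) (Q - m Q Q)"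
    using rel(3) by (simp add: ml unit algebra_simps)
  have "m Q' (m (m R Q) Q') = m Q' (m (m Q R) Q') + s (\<i> * A) (m Q' (m Q Q') - m Q' (m (m Q Q) Q'))"
    by (simp add: RQ ml)
  hence RQ': "m R Q' = m Q' R - s (\<i> * A) (Q' - e)"
    by (simp add: assoc QQ' rel unit)
  have Rz: "m R (zp n) = m (zp n) R + s (\<i> * A * of_int n) (zp n - zp (n + 1))" for n
  proof (induction n rule: int_induct[where k=0])
    case base show ?case by (simp add: z0 unit)
  next
    case (step1 i)
    have "m R (zp (i + 1)) = m (m R Q) (zp i)" by (simp add: zQ[symmetric] assoc)
    also have "\<dots> = m Q (m R (zp i)) + s (\<i> * A) (zp (i + 1) - zp (i + 1 + 1))"
      by (simp add: RQ ml assoc zQ)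
    also have "m Q (m R (zp i)) = m (zp (i + 1)) R + s (\<i> * A * of_int i) (zp (i + 1) - zp (i + 1 + 1))"
      by (simp add: step1.IH ml zQ assoc[symmetric])
    finally show ?case by (simp add: algebra_simps V.scale_left_distrib)
  next
    case (step2 i)
    have "m R (zp (i - 1)) = m (m R Q') (zp i)" by (simp add: zQ'[symmetric] assoc)
    also have "\<dots> = m Q' (m R (zp i)) - s (\<i> * A) (zp (i - 1) - zp i)"
      by (simp add: RQ' ml assoc zQ' unit)
    also have "m Q' (m R (zp i)) = m (zp (i - 1)) R + s (\<i> * A * of_int i) (zp (i - 1) - zp i)"
      by (simp add: step2.IH ml zQ' assoc[symmetric])
    finally show ?case by (simp add: algebra_simps V.scale_left_distrib)
  qed
  define \<phi> where "\<phi> = lin_ext s (\<lambda>(n, k). m (zp n) ((m R ^^ k) e))"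
  have lphi: "lin scale s \<phi>" unfolding \<phi>_def by (rule lin_lin_ext[OF V.vector_space_axioms])
  have pm: "\<phi> (mon n k) = m (zp n) ((m R ^^ k) e)" for n k
    by (simp add: \<phi>_def mon_def lin_ext_bas V.vector_space_axioms)
  have pg: "\<phi> (mul_g n x) = m (zp n) (\<phi> x)" for n x
    by (rule lin_eq_monI[OF lin_comp[OF lin_mul_g lphi] lin_comp[OF lphi complex_algebraD(2)[OF alg]]])
       (simp add: pm zz assoc[symmetric])
  have pp: "\<phi> (mul_p A x) = m R (\<phi> x)" for x
    by (rule lin_eq_monI[OF lin_comp[OF lin_mul_p lphi] lin_comp[OF lphi complex_algebraD(2)[OF alg]]])
       (simp add: pm mul_p_mon linD[OF lphi] Rz ml assoc[symmetric])
  have mulR: "m ((m R ^^ k) e) x = (m R ^^ k) x" for k x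
    by (induction k) (simp_all add: unit assoc)
  have php: "\<phi> ((mul_p A ^^ k) x) = (m R ^^ k) (\<phi> x)" for k x
    by (induction k) (simp_all add: pp)
  have pmul: "\<phi> (mul A x y) = m (\<phi> x) (\<phi> y)" for x y
    by (rule lin_eq_monI[OF lin_comp[OF lin_mul_left lphi] lin_comp[OF lphi complex_algebraD(3)[OF alg]]])
       (simp add: mul_mon pg php pm assoc mulR)
  have "algebra_hom scale (mul A) 1 s m e \<phi>"
    using lphi pmul by (auto simp: algebra_hom_def one_mon pm z0 unit)
  moreover have "\<phi> gP = Q" "\<phi> pP = R"
    using zQ[of 0] by (simp_all add: pm z0 unit)
  ultimately show ?thesis
    using planck_hom_unique[OF alg] by (intro ex1I[of _ \<phi>]) auto
qed

subsection \<open>The Hopf algebra structure\<close>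

lemma lin_tensor_left: "lin scale scale (\<lambda>a. tensor a b)"
  unfolding tensor_def by (rule lin_lin_ext[OF vs_scale])
lemma lin_tensor_right: "lin scale scale (tensor a)"
  unfolding tensor_def by (rule lin_ext_lin) (rule lin_lin_ext[OF vs_scale])
lemmas tensor_simps = linD[OF lin_tensor_left] linD[OF lin_tensor_right]

lemma tensor_bas: "tensor (bas i) (bas j) = bas (i, j)"
  by (simp add: tensor_def lin_ext_bas vs_scale)

lemma lin_tmul_left: "lin scale scale (\<lambda>a. tensor_mul A a b)"
  unfolding tensor_mul_def by (rule lin_lin_ext[OF vs_scale])
lemma lin_tmul_right: "lin scale scale (tensor_mul A a)"
  unfolding tensor_mul_def by (rule lin_ext_lin) (auto simp: case_prod_unfold intro: lin_lin_ext[OF vs_scale])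
lemmas tmul_simps = linD[OF lin_tmul_left] linD[OF lin_tmul_right]

lemma tmul_bas: "tensor_mul A (bas (i, j)) (bas (k, l)) = tensor (mul A (bas i) (bas k)) (mul A (bas j) (bas l))"
  by (simp add: tensor_mul_def lin_ext_bas vs_scale)

lemma tmul_tensor: "tensor_mul A (tensor a b) (tensor c d) = tensor (mul A a c) (mul A b d)"
proof -
  have 1: "tensor_mul A (tensor (bas i) (bas j)) (tensor (bas k) (bas l)) = tensor (mul A (bas i) (bas k)) (mul A (bas j) (bas l))" for i j k l
    by (simp add: tensor_bas tmul_bas)
  have 2: "tensor_mul A (tensor (bas i) (bas j)) (tensor (bas k) d) = tensor (mul A (bas i) (bas k)) (mul A (bas j) d)" for i j k
    by (rule lin_eqI[OF lin_comp[OF lin_tensor_right lin_tmul_right] lin_comp[OF lin_mul_right lin_tensor_right]]) (rule 1)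
  have 3: "tensor_mul A (tensor (bas i) (bas j)) (tensor c d) = tensor (mul A (bas i) c) (mul A (bas j) d)" for i j
    by (rule lin_eqI[OF lin_comp[OF lin_tensor_left lin_tmul_right] lin_comp[OF lin_mul_right lin_tensor_left]]) (rule 2)
  have 4: "tensor_mul A (tensor (bas i) b) (tensor c d) = tensor (mul A (bas i) c) (mul A b d)" for i
    by (rule lin_eqI[OF lin_comp[OF lin_tensor_right lin_tmul_left] lin_comp[OF lin_mul_left lin_tensor_right]]) (rule 3)
  show ?thesis
    by (rule lin_eqI[OF lin_comp[OF lin_tensor_left lin_tmul_left] lin_comp[OF lin_mul_left lin_tensor_left]]) (rule 4)
qed

lemma lin_eq_tensorI:
  assumes "lin scale s \<phi>" "lin scale s \<psi>" "\<And>a b. \<phi> (tensor a b) = \<psi> (tensor a b)"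
  shows "\<phi> x = \<psi> x"
  by (rule lin_eqI[OF assms(1,2)]) (metis assms(3) tensor_bas surj_pair)

lemma tensor_algebra: "complex_algebra scale (tensor_mul A) (tensor 1 1)"
proof -
  have 1: "tensor_mul A (tensor 1 1) x = x" for x
    by (rule lin_eq_tensorI[OF lin_tmul_right lin_id]) (simp add: tmul_tensor)
  have 2: "tensor_mul A x (tensor 1 1) = x" for x
    by (rule lin_eq_tensorI[OF lin_tmul_left lin_id]) (simp add: tmul_tensor)
  have 31: "tensor_mul A (tensor_mul A (tensor a b) (tensor c d)) z = tensor_mul A (tensor a b) (tensor_mul A (tensor c d) z)" for a b c d z
    by (rule lin_eq_tensorI[OF lin_tmul_right lin_comp[OF lin_tmul_right lin_tmul_right]]) (simp add: tmul_tensor mul_assoc)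
  have 32: "tensor_mul A (tensor_mul A (tensor a b) y) z = tensor_mul A (tensor a b) (tensor_mul A y z)" for a b y z
    by (rule lin_eq_tensorI[OF lin_comp[OF lin_tmul_right lin_tmul_left] lin_comp[OF lin_tmul_left lin_tmul_right]]) (rule 31)
  have 3: "tensor_mul A (tensor_mul A x y) z = tensor_mul A x (tensor_mul A y z)" for x y z
    by (rule lin_eq_tensorI[OF lin_comp[OF lin_tmul_left lin_tmul_left] lin_tmul_left]) (rule 32)
  show ?thesis
    using vs_scale lin_tmul_left lin_tmul_right 1 2 3 by (simp add: complex_algebra_def)
qed

lemma coproduct_ex1: "\<exists>!D. is_coproduct A D"
proof -
  have "\<exists>!D. algebra_hom scale (mul A) 1 scale (tensor_mul A) (tensor 1 1) D \<and> D gP = tensor gP gP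
          \<and> D pP = tensor pP gP + tensor 1 pP"
    by (rule planck_universal[OF tensor_algebra, where Q' = "tensor gP_inv gP_inv"])
       (simp_all add: tmul_tensor tmul_simps tensor_simps mul_mon mul_p_mon lin_simps one_mon
         sc.scale_right_diff_distrib sc.scale_right_distrib)
  thus ?thesis by (simp add: is_coproduct_def conj_commute conj_left_commute conj_assoc)
qed

lemma coproduct: "is_coproduct A (coproduct A)"
  unfolding coproduct_def by (rule theI'[OF coproduct_ex1])

lemma counit_ex1: "\<exists>!e. is_counit A e"
proof -
  have vs: "vector_space ((*) :: complex \<Rightarrow> _)" by unfold_locales (auto simp: algebra_simps)
  have alg: "complex_algebra (*) (*) (1::complex)"
    unfolding complex_algebra_def using vs by (auto simp: Vector_Spaces.linear_iff algebra_simps)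
  have "\<exists>!e. algebra_hom scale (mul A) 1 (*) (*) 1 e \<and> e gP = 1 \<and> e pP = 0"
    by (rule planck_universal[OF alg, where Q' = 1]) simp_all
  thus ?thesis by (simp add: is_counit_def conj_commute conj_left_commute conj_assoc)
qed

lemma opposite_algebra: "complex_algebra scale (\<lambda>x y. mul A y x) 1"
  unfolding complex_algebra_def using vs_scale lin_mul_left lin_mul_right mul_assoc by auto

lemma antipode_ex1: "\<exists>!S. is_antipode A S"
proof -
  have "\<exists>!S. algebra_hom scale (mul A) 1 scale (\<lambda>x y. mul A y x) 1 S \<and> S gP = gP_inv
          \<and> S pP = - mul A pP gP_inv"
    by (rule planck_universal[OF opposite_algebra, where Q' = gP])
       (simp_all add: mul_mon mul_p_mon lin_simps one_mon
         sc.scale_right_diff_distrib sc.scale_right_distrib sc.scale_minus_left)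
  thus ?thesis by (simp add: is_antipode_def conj_commute conj_left_commute conj_assoc)
qed

lemma antipode: "is_antipode A (antipode A)"
  unfolding antipode_def by (rule theI'[OF antipode_ex1])

lemma antipode_simps:
  "lin scale scale (antipode A)" "antipode A 1 = 1" "antipode A (mul A x y) = mul A (antipode A y) (antipode A x)"
  "antipode A pP = - mul A pP gP_inv" "antipode A gP = gP_inv"
  using antipode[of A] by (auto simp: is_antipode_def algebra_hom_def)

lemma antipode_g_inv: "antipode A gP_inv = gP"
proof -
  have "mul A gP_inv (antipode A gP_inv) = 1"
    using antipode_simps(3)[of A gP_inv gP] by (simp only: g_relations(2,3) antipode_simps)
  hence "mul A gP (mul A gP_inv (antipode A gP_inv)) = mul A gP 1" by simp
  thus ?thesis by (simp add: mul_mon)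
qed

lemma bij_antipode: "bij (antipode A)"
proof -
  have "\<exists>!T. algebra_hom scale (mul A) 1 scale (\<lambda>x y. mul A y x) 1 T \<and> T gP = gP_inv
          \<and> T pP = - mul A gP_inv pP"
    by (rule planck_universal[OF opposite_algebra, where Q' = gP])
       (simp_all add: mul_mon mul_p_mon lin_simps one_mon
         sc.scale_right_diff_distrib sc.scale_right_distrib sc.scale_minus_left)
  then obtain T where T: "algebra_hom scale (mul A) 1 scale (\<lambda>x y. mul A y x) 1 T"
    "T gP = gP_inv" "T pP = - mul A gP_inv pP" by blast
  note T' = algebra_homD[OF T(1)]
  have "mul A gP_inv (T gP_inv) = 1"
    using T'(3)[of gP_inv gP] by (simp only: g_relations(2,3) T T')
  hence "mul A gP (mul A gP_inv (T gP_inv)) = mul A gP 1" by simp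
  hence Tg: "T gP_inv = gP" by (simp add: mul_mon)
  have id: "algebra_hom scale (mul A) 1 scale (mul A) 1 (\<lambda>x. x)"
    by (simp add: algebra_hom_def lin_id)
  have h1: "algebra_hom scale (mul A) 1 scale (mul A) 1 (\<lambda>x. T (antipode A x))"
    "algebra_hom scale (mul A) 1 scale (mul A) 1 (\<lambda>x. antipode A (T x))"
    using antipode_simps T' by (auto simp: algebra_hom_def intro: lin_comp)
  have "(\<lambda>x. T (antipode A x)) = (\<lambda>x. x)"
    by (rule planck_hom_unique[OF planck_algebra h1(1) id])
       (simp_all only: antipode_simps T Tg T' linD[OF T'(1)], simp_all add: mul_mon lin_simps)
  moreover have "(\<lambda>x. antipode A (T x)) = (\<lambda>x. x)"
    by (rule planck_hom_unique[OF planck_algebra h1(2) id])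
       (simp_all only: antipode_simps T T' antipode_g_inv linD[OF antipode_simps(1)], simp_all add: mul_mul_p mul_p_mon mul_mon lin_simps)
  ultimately show ?thesis
    by (intro o_bij[of T]) (auto simp: fun_eq_iff)
qed

subsection \<open>The calculus\<close>

lemma calculus_alg:
  fixes A :: complex
  defines "s \<equiv> \<lambda>c (a, x, y). (scale c a, scale c x, scale c y)"
    and "m \<equiv> \<lambda>(a, x, y) (b, x', y'). (mul A a b, mul A x b + mul A a x' + scale (\<i> * A) (mul A x y'),
            mul A y b + mul A a y' + scale (\<i> * A) (mul A y y'))"
  shows "complex_algebra s m (1, 0, 0)"
proof -
  have vs: "vector_space s"
    by unfold_locales (auto simp: s_def sc.scale_right_distrib sc.scale_left_distrib)
  show ?thesis
    unfolding complex_algebra_def using vs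
    by (auto simp: Vector_Spaces.linear_iff lin_simps s_def m_def sc.scale_right_distrib mul_assoc algebra_simps)
qed

lemma sum_ix: "(\<Sum>i\<in>UNIV. f i) = f Xi + f Eta"
proof -
  have *: "UNIV = {Xi, Eta}" using ix.exhaust by auto
  show ?thesis unfolding * by simp
qed

lemma all_ix: "(\<forall>i. P i) \<longleftrightarrow> P Xi \<and> P Eta"
  by (metis ix.exhaust)

lemma std_gens:
  "d gP = left_mul A d gP (basis_form Xi) \<longleftrightarrow> d gP Xi = gP \<and> d gP Eta = 0"
  "d pP = left_mul A d gP (basis_form Eta) \<longleftrightarrow> d pP Xi = scale (\<i> * A) (d gP Xi) \<and> d pP Eta = gP + scale (\<i> * A) (d gP Eta)"
  by (auto simp: fun_eq_iff left_mul_def basis_form_def all_ix lin_simps)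

lemma std_calculus_iff:
  "is_standard_calculus A d \<longleftrightarrow>
    (let F = (\<lambda>a. (a, d a Xi, d a Eta)) in
     algebra_hom scale (mul A) 1 (\<lambda>c (a, x, y). (scale c a, scale c x, scale c y))
      (\<lambda>(a, x, y) (b, x', y'). (mul A a b, mul A x b + mul A a x' + scale (\<i> * A) (mul A x y'),
            mul A y b + mul A a y' + scale (\<i> * A) (mul A y y'))) (1, 0, 0) F
     \<and> F gP = (gP, gP, 0) \<and> F pP = (pP, scale (\<i> * A) gP, gP))" (is "?L \<longleftrightarrow> ?R")
proof
  assume L: ?L
  have leib: "d (mul A a b) i = mul A (d a i) b + mul A a (d b i) + scale (\<i> * A) (mul A (d a i) (d b Eta))" for a b i
    using L by (auto simp: is_standard_calculus_def right_mul_def left_mul_def fun_eq_iff algebra_simps)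
  have 1: "lin scale scale (\<lambda>a. d a i)" for i
    using L by (simp add: is_standard_calculus_def)
  have e: "d gP Eta = 0" "d gP Xi = gP" "d pP Xi = scale (\<i> * A) gP" "d pP Eta = gP"
    using L by (simp_all add: is_standard_calculus_def std_gens del: One_nat_def)
  have "d gP Eta = mul A (d 1 Eta) gP + d gP Eta" using leib[of 1 gP Eta] e by (simp add: lin_simps)
  hence "mul A (mul A (d 1 Eta) gP) gP_inv = 0" by (simp add: lin_simps)
  hence d1e: "d 1 Eta = 0" by (simp add: mul_assoc g_relations(2))
  have "d gP Xi = mul A (d 1 Xi) gP + d gP Xi" using leib[of 1 gP Xi] e by (simp add: lin_simps)
  hence "mul A (mul A (d 1 Xi) gP) gP_inv = 0" by (simp add: lin_simps)
  hence d1: "d 1 Xi = 0" by (simp add: mul_assoc g_relations(2))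
  have vs: "vector_space (\<lambda>c (a::fn, x::fn, y::fn). (scale c a, scale c x, scale c y))"
    using complex_algebraD(1)[OF calculus_alg] .
  show ?R
    using d1 d1e leib e vs
    by (simp add: Let_def algebra_hom_def Vector_Spaces.linear_iff vs_scale linD[OF 1] algebra_simps)
next
  assume ?R
  hence R: "algebra_hom scale (mul A) 1 (\<lambda>c (a, x, y). (scale c a, scale c x, scale c y))
      (\<lambda>(a, x, y) (b, x', y'). (mul A a b, mul A x b + mul A a x' + scale (\<i> * A) (mul A x y'),
            mul A y b + mul A a y' + scale (\<i> * A) (mul A y y'))) (1, 0, 0) (\<lambda>a. (a, d a Xi, d a Eta))"
    "d gP Xi = gP" "d gP Eta = 0" "d pP Xi = scale (\<i> * A) gP" "d pP Eta = gP"
    by (auto simp: Let_def)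
  have "lin scale scale (\<lambda>a. d a i)" for i
    by (rule sc_linI) (cases i; use algebra_homD(1)[OF R(1)] in \<open>simp add: Vector_Spaces.linear_iff\<close>)+
  moreover have "d (mul A a b) i = mul A (d a i) b + mul A a (d b i) + scale (\<i> * A) (mul A (d a i) (d b Eta))" for a b i
    using algebra_homD(3)[OF R(1), of a b] by (cases i) auto
  moreover have "d gP = left_mul A d gP (basis_form Xi)" "d pP = left_mul A d gP (basis_form Eta)"
    unfolding std_gens using R by simp_all
  ultimately show ?L
    by (auto simp: is_standard_calculus_def right_mul_def left_mul_def[of A d _ "d _"] fun_eq_iff add.assoc)
qed

lemma scale_2: "scale c (2 * x) = 2 * scale c (x :: fn)"
  by (simp only: mult_2 sc.scale_right_distrib)

lemma calculus_ex1: "\<exists>!d. is_standard_calculus A d"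
proof -
  let ?s = "\<lambda>c (a::fn, x::fn, y::fn). (scale c a, scale c x, scale c y)"
  let ?m = "\<lambda>(a, x, y) (b, x', y'). (mul A a b, mul A x b + mul A a x' + scale (\<i> * A) (mul A x y'),
            mul A y b + mul A a y' + scale (\<i> * A) (mul A y y'))"
  have ex1: "\<exists>!F. algebra_hom scale (mul A) 1 ?s ?m (1, 0, 0) F \<and> F gP = (gP, gP, 0) \<and> F pP = (pP, scale (\<i> * A) gP, gP)"
    by (rule planck_universal[OF calculus_alg, where Q' = "(gP_inv, - gP_inv, 0)"])
       (simp_all add: mul_mon mul_p_mon lin_simps one_mon
         sc.scale_right_diff_distrib sc.scale_right_distrib scale_2)
  then obtain F where F: "algebra_hom scale (mul A) 1 ?s ?m (1, 0, 0) F" "F gP = (gP, gP, 0)" "F pP = (pP, scale (\<i> * A) gP, gP)"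
    by blast
  have "algebra_hom scale (mul A) 1 scale (mul A) 1 (\<lambda>a. fst (F a))"
    using F(1) by (auto simp: algebra_hom_def Vector_Spaces.linear_iff vs_scale case_prod_unfold)
  moreover have "algebra_hom scale (mul A) 1 scale (mul A) 1 (\<lambda>a. a)"
    by (simp add: algebra_hom_def lin_id)
  ultimately have "(\<lambda>a. fst (F a)) = (\<lambda>a. a)"
    by (rule planck_hom_unique[OF planck_algebra]) (simp_all add: F(2,3) del: One_nat_def)
  hence fst: "fst (F a) = a" for a by (simp add: fun_eq_iff)
  define d where "d = (\<lambda>a i. case i of Xi \<Rightarrow> fst (snd (F a)) | Eta \<Rightarrow> snd (snd (F a)))"
  have Fd: "(\<lambda>a. (a, d a Xi, d a Eta)) = F"
    by (auto simp: d_def fun_eq_iff prod_eq_iff fst)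
  have "is_standard_calculus A d"
    unfolding std_calculus_iff Let_def Fd using F by simp
  moreover have "d' = d" if "is_standard_calculus A d'" for d'
  proof -
    have "(\<lambda>a. (a, d' a Xi, d' a Eta)) = F"
      using ex1 F that unfolding std_calculus_iff Let_def by blast
    hence "(\<lambda>a. (a, d' a Xi, d' a Eta)) = (\<lambda>a. (a, d a Xi, d a Eta))"
      by (rule trans[OF _ Fd[symmetric]])
    hence "(a, d' a Xi, d' a Eta) = (a, d a Xi, d a Eta)" for a
      by (rule fun_cong)
    hence "d' a i = d a i" for a i by (cases i) simp_all
    thus ?thesis by (intro ext)
  qed
  ultimately show ?thesis by blast
qed

lemma calculus: "is_standard_calculus A (dP A)"
  unfolding dP_def by (rule theI'[OF calculus_ex1])

lemma lin_dP: "lin scale scale (\<lambda>a. dP A a i)"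
  using calculus by (simp add: is_standard_calculus_def)
lemmas dP_simps = linD[OF lin_dP]

lemma dP_mul: "dP A (mul A a b) i = mul A (dP A a i) b + mul A a (dP A b i) + scale (\<i> * A) (mul A (dP A a i) (dP A b Eta))"
  using calculus by (auto simp: is_standard_calculus_def right_mul_def left_mul_def fun_eq_iff algebra_simps)

lemma dP_hom:
  "algebra_hom scale (mul A) 1 (\<lambda>c (a, x, y). (scale c a, scale c x, scale c y))
      (\<lambda>(a, x, y) (b, x', y'). (mul A a b, mul A x b + mul A a x' + scale (\<i> * A) (mul A x y'),
            mul A y b + mul A a y' + scale (\<i> * A) (mul A y y'))) (1, 0, 0) (\<lambda>a. (a, dP A a Xi, dP A a Eta))"
  using calculus[of A] unfolding std_calculus_iff Let_def by (rule conjunct1)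

lemma dP_gens: "dP A gP Xi = gP" "dP A gP Eta = 0" "dP A pP Xi = scale (\<i> * A) gP" "dP A pP Eta = gP"
  using calculus[of A] unfolding std_calculus_iff Let_def by (auto simp del: One_nat_def)

lemma dP_1: "dP A 1 i = 0"
  using algebra_homD(2)[OF dP_hom[of A]] by (cases i) auto

lemma dP_ginv: "dP A gP_inv Xi = - gP_inv" "dP A gP_inv Eta = 0"
proof -
  have e: "mul A (mul A (dP A gP_inv i) gP) gP_inv = dP A gP_inv i" for i by (simp add: mul_assoc g_relations(2))
  have "0 = mul A (dP A gP_inv Eta) gP" "0 = mul A (dP A gP_inv Xi) gP + 1"
    using dP_mul[of A gP_inv gP Eta] dP_mul[of A gP_inv gP Xi]
    by (simp_all only: g_relations(3) dP_1 dP_gens lin_simps) (simp_all add: g_relations one_mon)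
  hence "mul A (dP A gP_inv Eta) gP = 0" "mul A (dP A gP_inv Xi) gP = - 1"
    by (simp_all add: eq_neg_iff_add_eq_0)
  thus "dP A gP_inv Xi = - gP_inv" "dP A gP_inv Eta = 0"
    using e[of Xi] e[of Eta] by (simp_all add: lin_simps)
qed

subsection \<open>The action on \<open>V\<close>\<close>

abbreviation "lm A \<equiv> left_mul A (dP A)"

lemma lin_lm_left: "lin scale scale (\<lambda>a. lm A a \<omega> i)"
  unfolding left_mul_def by (intro lin_add lin_mul_left lin_scale lin_comp[OF lin_dP lin_mul_left])
lemma lm_mul: "lm A (mul A a b) \<omega> = lm A a (lm A b \<omega>)"
  by (rule ext) (simp add: left_mul_def dP_mul lin_simps mul_assoc sc.scale_right_distrib ac_simps)
lemma lm_1: "lm A 1 \<omega> = \<omega>"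
  by (rule ext) (simp add: left_mul_def dP_1 lin_simps)
lemma lm_rm: "lm A a (right_mul A \<omega> b) = right_mul A (lm A a \<omega>) b"
  by (rule ext) (simp add: left_mul_def right_mul_def lin_simps mul_assoc)

definition AdF :: "complex \<Rightarrow> _ \<Rightarrow> form1 \<Rightarrow> form1" where
  "AdF A t \<omega> = (\<lambda>j. lin_ext scale (\<lambda>(k, l). right_mul A (lm A (bas k) \<omega>) (antipode A (bas l)) j) t)"

lemma adjoint_AdF: "adjoint A h i = AdF A (coproduct A h) (basis_form i)"
  by (simp add: adjoint_def AdF_def)

lemma lin_AdF: "lin scale scale (\<lambda>t. AdF A t \<omega> j)"
  unfolding AdF_def by (rule lin_lin_ext[OF vs_scale])

lemma lin_rm: "lin scale scale (\<lambda>a. right_mul A (lm A a \<omega>) b j)" "lin scale scale (\<lambda>b. right_mul A \<omega> b j)"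
  unfolding right_mul_def by (intro lin_comp[OF lin_lm_left lin_mul_left] lin_mul_right)+

lemma AdF_tensor: "AdF A (tensor a b) \<omega> = right_mul A (lm A a \<omega>) (antipode A b)"
proof (rule ext)
  fix j
  have 1: "AdF A (tensor (bas i) (bas k)) \<omega> j = right_mul A (lm A (bas i) \<omega>) (antipode A (bas k)) j" for i k
    by (simp add: AdF_def tensor_bas lin_ext_bas vs_scale)
  have 2: "AdF A (tensor (bas i) b) \<omega> j = right_mul A (lm A (bas i) \<omega>) (antipode A b) j" for i
    by (rule lin_eqI[OF lin_comp[OF lin_tensor_right lin_AdF] lin_comp[OF antipode_simps(1) lin_rm(2)]]) (rule 1)
  show "AdF A (tensor a b) \<omega> j = right_mul A (lm A a \<omega>) (antipode A b) j"
    by (rule lin_eqI[OF lin_comp[OF lin_tensor_left lin_AdF] lin_rm(1)]) (rule 2)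
qed

lemma AdF_lincomb: "AdF A t (\<lambda>i. scale c (\<omega> i) + scale c' (\<omega>' i)) j = scale c (AdF A t \<omega> j) + scale c' (AdF A t \<omega>' j)"
  by (rule lin_eq_tensorI[OF lin_AdF lin_add[OF lin_scale[OF lin_AdF] lin_scale[OF lin_AdF]]])
     (simp add: AdF_tensor right_mul_def left_mul_def lin_simps sc.scale_right_distrib ac_simps)

lemma rm_rm: "right_mul A (right_mul A \<omega> a) b = right_mul A \<omega> (mul A a b)"
  by (rule ext) (simp add: right_mul_def mul_assoc)

lemma AdF_tmul: "AdF A (tensor_mul A s t) \<omega> j = AdF A s (AdF A t \<omega>) j"
proof -
  have lin2: "lin scale scale (\<lambda>t. AdF A s (AdF A t \<omega>) j)" for s
  proof (rule sc_linI)
    fix x y c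
    have "AdF A (x + y) \<omega> = (\<lambda>i. AdF A x \<omega> i + AdF A y \<omega> i)" "AdF A (scale c x) \<omega> = (\<lambda>i. scale c (AdF A x \<omega> i))"
      by (intro ext, simp add: linD[OF lin_AdF])+
    note this [simp]
    show "AdF A s (AdF A (x + y) \<omega>) j = AdF A s (AdF A x \<omega>) j + AdF A s (AdF A y \<omega>) j"
      using AdF_lincomb[of A s 1 "AdF A x \<omega>" 1 "AdF A y \<omega>" j] by simp
    show "AdF A s (AdF A (scale c x) \<omega>) j = scale c (AdF A s (AdF A x \<omega>) j)"
      using AdF_lincomb[of A s c "AdF A x \<omega>" 0 "AdF A x \<omega>" j] by simp
  qed
  have 1: "AdF A (tensor_mul A (tensor a b) t) \<omega> j = AdF A (tensor a b) (AdF A t \<omega>) j" for a b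
    by (rule lin_eq_tensorI[OF lin_comp[OF lin_tmul_right lin_AdF] lin2])
       (simp add: tmul_tensor AdF_tensor lm_mul lm_rm antipode_simps rm_rm)
  show ?thesis
    by (rule lin_eq_tensorI[OF lin_comp[OF lin_tmul_left lin_AdF] lin_AdF]) (rule 1)
qed

lemma coproduct_simps:
  "lin scale scale (coproduct A)" "coproduct A 1 = tensor 1 1"
  "coproduct A (mul A x y) = tensor_mul A (coproduct A x) (coproduct A y)"
  "coproduct A pP = tensor pP gP + tensor 1 pP" "coproduct A gP = tensor gP gP"
  using coproduct[of A] by (auto simp: is_coproduct_def algebra_hom_def)

lemma coproduct_ginv: "coproduct A gP_inv = tensor gP_inv gP_inv"
proof -
  note alg = complex_algebraD[OF tensor_algebra[of A]]
  have "tensor_mul A (coproduct A gP_inv) (coproduct A gP) = tensor 1 1"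
    by (simp only: coproduct_simps(3)[symmetric] g_relations(3) coproduct_simps(2))
  hence "tensor_mul A (tensor_mul A (coproduct A gP_inv) (coproduct A gP)) (tensor gP_inv gP_inv) = tensor gP_inv gP_inv"
    by (simp add: alg)
  moreover have "tensor_mul A (coproduct A gP) (tensor gP_inv gP_inv) = tensor 1 1"
    by (simp add: coproduct_simps tmul_tensor g_relations(2))
  ultimately show ?thesis by (simp add: alg(4,6))
qed

lemma coproduct_mon_g: "coproduct A (mon n 0) = tensor (mon n 0) (mon n 0)"
proof (induction n rule: int_induct[where k=0])
  case base show ?case using coproduct_simps(2)[of A] by (simp add: one_mon)
next
  case (step1 i)
  thus ?case using coproduct_simps(3)[of A gP "mon i 0"] by (simp add: coproduct_simps g_relations tmul_tensor add.commute)
next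
  case (step2 i)
  thus ?case using coproduct_simps(3)[of A gP_inv "mon i 0"] by (simp add: coproduct_ginv g_relations tmul_tensor)
qed

definition acts :: "complex \<Rightarrow> fn \<Rightarrow> (ix \<Rightarrow> ix \<Rightarrow> complex) \<Rightarrow> bool" where
  "acts A h c \<longleftrightarrow> (\<forall>i j. adjoint A h i j = scale (c i j) 1)"

lemma scale_1_inj: "scale c (1::fn) = scale c' 1 \<longleftrightarrow> c = c'"
  by (metis sc.scale_cancel_right zero_neq_one)

lemma acts_actV: "acts A h c \<Longrightarrow> actV A h = c"
  by (intro ext) (auto simp: acts_def actV_def scale_1_inj)

lemma acts_mul:
  assumes "acts A h c" "acts A k d"
  shows "acts A (mul A h k) (\<lambda>i j. d i Xi * c Xi j + d i Eta * c Eta j)"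
  unfolding acts_def
proof (intro allI)
  fix i j
  have "adjoint A (mul A h k) i j = AdF A (coproduct A h) (adjoint A k i) j"
    by (simp add: adjoint_AdF coproduct_simps AdF_tmul)
  also have "adjoint A k i = (\<lambda>l. scale (d i Xi) (basis_form Xi l) + scale (d i Eta) (basis_form Eta l))"
    using assms(2) by (intro ext) (rename_tac l, case_tac l; simp add: acts_def basis_form_def)
  also have "AdF A (coproduct A h) \<dots> j = scale (d i Xi) (adjoint A h Xi j) + scale (d i Eta) (adjoint A h Eta j)"
    by (simp add: AdF_lincomb adjoint_AdF)
  finally show "adjoint A (mul A h k) i j = scale (d i Xi * c Xi j + d i Eta * c Eta j) 1"
    using assms(1) by (simp add: acts_def sc.scale_left_distrib)
qed

lemma acts_lin:
  assumes "acts A h c" "acts A k d"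
  shows "acts A (h + k) (\<lambda>i j. c i j + d i j)" "acts A (scale x h) (\<lambda>i j. x * c i j)"
  using assms by (auto simp: acts_def adjoint_AdF linD[OF coproduct_simps(1)] linD[OF lin_AdF] sc.scale_left_distrib)

definition matr :: "complex \<Rightarrow> complex \<Rightarrow> complex \<Rightarrow> complex \<Rightarrow> ix \<Rightarrow> ix \<Rightarrow> complex" where
  "matr a b c d i j = (case i of Xi \<Rightarrow> (case j of Xi \<Rightarrow> a | Eta \<Rightarrow> b) | Eta \<Rightarrow> (case j of Xi \<Rightarrow> c | Eta \<Rightarrow> d))"
lemma matr_simps [simp]: "matr a b c d Xi Xi = a" "matr a b c d Xi Eta = b" "matr a b c d Eta Xi = c" "matr a b c d Eta Eta = d"
  by (simp_all add: matr_def)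

lemma acts_1: "acts A 1 (matr 1 0 0 1)"
  by (simp add: acts_def all_ix adjoint_AdF coproduct_simps AdF_tensor lm_1 antipode_simps right_mul_def basis_form_def)

lemma acts_g: "acts A gP (matr 1 0 (\<i> * A) 1)"
  by (simp add: acts_def all_ix adjoint_AdF coproduct_simps AdF_tensor left_mul_def antipode_simps right_mul_def
     basis_form_def dP_gens lin_simps g_relations)
     (simp add: mul_mon one_mon)

lemma acts_ginv: "acts A gP_inv (matr 1 0 (- (\<i> * A)) 1)"
  by (simp add: acts_def all_ix adjoint_AdF coproduct_ginv AdF_tensor left_mul_def antipode_g_inv right_mul_def
     basis_form_def dP_ginv lin_simps g_relations)
     (simp add: mul_mon one_mon)

lemma acts_p: "acts A pP (matr 0 0 ((\<i> * A)\<^sup>2) (\<i> * A))"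
  unfolding acts_def all_ix
  by (simp add: adjoint_AdF coproduct_simps linD[OF lin_AdF] AdF_tensor left_mul_def antipode_simps right_mul_def
     basis_form_def dP_gens dP_1 lin_simps power2_eq_square del: One_nat_def)
     (simp add: mul_mon lin_simps one_mon mul_mul_p mul_p_mon)

lemma acts_ex: "\<exists>c. acts A h c"
proof -
  have g: "\<exists>c. acts A (mon n 0) c" for n
  proof (induction n rule: int_induct[where k=0])
    case base show ?case using acts_1 by (auto simp: one_mon)
  next
    case (step1 i)
    thus ?case using acts_mul[OF acts_g] by (fastforce simp: g_relations add.commute)
  next
    case (step2 i)
    thus ?case using acts_mul[OF acts_ginv] by (fastforce simp: g_relations)
  qed
  have p: "\<exists>c. acts A (mon 0 m) c" for m
  proof (induction m)
    case 0 show ?case using g by simp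
  next
    case (Suc m)
    then obtain c where "acts A (mon 0 m) c" by blast
    from acts_mul[OF acts_p this] show ?case unfolding p_powers by blast
  qed
  have gp: "\<exists>c. acts A (mon n m) c" for n m
  proof -
    obtain c d where "acts A (mon n 0) c" "acts A (mon 0 m) d" using g p by blast
    from acts_mul[OF this] show ?thesis unfolding normal_order by blast
  qed
  have z: "acts A 0 (\<lambda>i j. 0)"
    by (simp add: acts_def adjoint_AdF linD[OF coproduct_simps(1)] linD[OF lin_AdF])
  have "\<exists>c. acts A (\<Sum>k\<in>K. scale (Poly_Mapping.lookup h k) (bas k)) c" if "finite K" for K
    using that
  proof induction
    case empty thus ?case using z by auto
  next
    case (insert k K)
    thus ?case using gp[of "fst k" "snd k"] acts_lin by (simp add: bas_mon) blast
  qed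
  thus ?thesis by (metis poly_mapping_sum_bas finite_keys)
qed

lemma acts_iff: "acts A h c \<longleftrightarrow> actV A h = c"
  using acts_ex acts_actV by metis

lemma actV_unique: "adjoint A h i j = scale (actV A h i j) 1"
  using acts_iff acts_def by metis

lemma actV_simps:
  "actV A 1 = matr 1 0 0 1" "actV A gP = matr 1 0 (\<i> * A) 1" "actV A gP_inv = matr 1 0 (- (\<i> * A)) 1"
  "actV A pP = matr 0 0 ((\<i> * A)\<^sup>2) (\<i> * A)" "actV A 0 i j = 0"
  "actV A (mul A h k) i j = actV A k i Xi * actV A h Xi j + actV A k i Eta * actV A h Eta j"
  "actV A (h + k) i j = actV A h i j + actV A k i j" "actV A (scale x h) i j = x * actV A h i j"
  using acts_1 acts_g acts_ginv acts_p acts_mul[of A h "actV A h" k "actV A k"]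
     acts_lin[of A h "actV A h" k "actV A k"] acts_lin(2)[of A 0 "actV A 0" 0 "actV A 0" 0]
  by (auto simp: acts_iff)

subsection \<open>Evaluation on \<open>L \<otimes> V\<close>\<close>

lemma inv_antipode: "inv (antipode A) gP_inv = gP" "inv (antipode A) 0 = 0"
  using inv_f_f[OF bij_is_inj[OF bij_antipode], of A gP] inv_f_f[OF bij_is_inj[OF bij_antipode], of A 0]
  by (simp_all add: antipode_simps linD[OF antipode_simps(1)])

lemma counit: "is_counit A (counit A)"
  unfolding counit_def by (rule theI'[OF counit_ex1])

lemma counit_simps:
  "lin scale (*) (counit A)" "counit A 1 = 1" "counit A (mul A x y) = counit A x * counit A y"
  "counit A pP = 0" "counit A gP = 1"
  using counit[of A] by (auto simp: is_counit_def algebra_hom_def)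

lemma counit_ginv: "counit A gP_inv = 1"
  using counit_simps(3)[of A gP_inv gP] by (simp add: g_relations(3) counit_simps)

lemma planck_induct [case_names one g ginv p lin]:
  assumes "P 1" "\<And>x. P x \<Longrightarrow> P (mul A gP x)" "\<And>x. P x \<Longrightarrow> P (mul A gP_inv x)" "\<And>x. P x \<Longrightarrow> P (mul A pP x)"
    and "\<And>c x y. P x \<Longrightarrow> P y \<Longrightarrow> P (scale c x + y)"
  shows "P h"
proof -
  have gx: "P (mul A (mon n 0) x)" if "P x" for n x
  proof (induction n rule: int_induct[where k=0])
    case base show ?case using that by (simp add: mul_mon)
  next
    case (step1 i)
    have "mul A gP (mul A (mon i 0) x) = mul A (mon (i + 1) 0) x" by (simp add: mul_mon add.commute)
    thus ?case using assms(2)[OF step1.IH] by (simp only:)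
  next
    case (step2 i)
    have "mul A gP_inv (mul A (mon i 0) x) = mul A (mon (i - 1) 0) x" by (simp add: mul_mon)
    thus ?case using assms(3)[OF step2.IH] by (simp only:)
  qed
  have p: "P (mon 0 m)" for m
  proof (induction m)
    case 0 show ?case using assms(1) by (simp add: one_mon)
  next
    case (Suc m) show ?case using assms(4)[OF Suc] unfolding p_powers .
  qed
  have b: "P (bas k)" for k using gx[OF p, of "fst k" "snd k"] unfolding normal_order bas_mon .
  have z: "P 0" using assms(5)[OF assms(1,1), of "-1"] by simp
  have "P (\<Sum>k\<in>K. scale (Poly_Mapping.lookup h k) (bas k))" if "finite K" for K
    using that
  proof induction
    case empty thus ?case using z by simp
  next
    case (insert k K)
    show ?case unfolding sum.insert[OF insert.hyps(1,2)] by (rule assms(5)[OF b insert.IH])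
  qed
  thus ?thesis using poly_mapping_sum_bas[of h] by (metis finite_keys)
qed

text \<open>\<open>S h\<^sub>1 h\<^sub>2 = \<epsilon>(h)\<close>\<close>

lemma antipode_convolution:
  "lin_ext scale (\<lambda>(k, l). mul A (antipode A (bas k)) (bas l)) (coproduct A h) = scale (counit A h) 1"
proof -
  define M where "M = lin_ext scale (\<lambda>(k, l). mul A (antipode A (bas k)) (bas l))"
  have lM: "lin scale scale M" unfolding M_def by (rule lin_lin_ext[OF vs_scale])
  have M1: "M (tensor (bas k) b) = mul A (antipode A (bas k)) b" for k b
    by (rule lin_eqI[OF lin_comp[OF lin_tensor_right lM] lin_mul_right])
       (simp add: M_def tensor_bas lin_ext_bas vs_scale)
  have Mt: "M (tensor a b) = mul A (antipode A a) b" for a b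
    by (rule lin_eqI[OF lin_comp[OF lin_tensor_left lM] lin_comp[OF antipode_simps(1) lin_mul_left]]) (rule M1)
  have G: "M (tensor_mul A (tensor gP gP) t) = M t" for t
    by (rule lin_eq_tensorI[OF lin_comp[OF lin_tmul_right lM] lM])
       (simp add: tmul_tensor Mt antipode_simps, simp add: mul_assoc, simp add: mul_mon)
  have G': "M (tensor_mul A (tensor gP_inv gP_inv) t) = M t" for t
    by (rule lin_eq_tensorI[OF lin_comp[OF lin_tmul_right lM] lM])
       (simp add: tmul_tensor Mt antipode_simps antipode_g_inv, simp add: mul_assoc, simp add: mul_mon)
  have z: "lin scale scale (\<lambda>t::((int \<times> nat) \<times> (int \<times> nat)) \<Rightarrow>\<^sub>0 complex. 0 :: fn)" by (intro sc_linI) auto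
  have Q: "M (tensor_mul A (tensor pP gP + tensor 1 pP) t) = 0" for t
    by (rule lin_eq_tensorI[OF lin_comp[OF lin_tmul_right lM] z])
       (simp add: tmul_simps tmul_tensor linD[OF lM] Mt antipode_simps mul_assoc lin_simps del: One_nat_def,
        simp add: mul_mon)
  have "M (coproduct A h) = scale (counit A h) 1"
  proof (induction h rule: planck_induct[where A = A])
    case one show ?case by (simp add: coproduct_simps Mt antipode_simps counit_simps)
  next
    case (lin c x y)
    thus ?case by (simp add: linD[OF coproduct_simps(1)] linD[OF lM] linD[OF counit_simps(1)] sc.scale_left_distrib)
  qed (simp_all add: coproduct_simps coproduct_ginv G G' Q counit_simps counit_ginv del: One_nat_def)
  thus ?thesis by (simp add: M_def)
qed

lemma evaluation_module_morphism:
  "lin_ext (*) (\<lambda>(h1, h2). \<Sum>k\<in>UNIV. actL A (bas h1) i k * actV A (bas h2) j k) (coproduct A h)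
     = (if i = j then counit A h else 0)"
proof -
  have vs: "vector_space ((*) :: complex \<Rightarrow> _)" by unfold_locales (auto simp: algebra_simps)
  have l: "lin scale (*) (\<lambda>h. actV A h j i)" by (intro linI vs_scale vs actV_simps)
  have "(\<Sum>k\<in>UNIV. actL A (bas h1) i k * actV A (bas h2) j k) = actV A (mul A (antipode A (bas h1)) (bas h2)) j i" for h1 h2
    by (simp add: actL_def actV_simps sum_ix mult.commute)
  hence "lin_ext (*) (\<lambda>(h1, h2). \<Sum>k\<in>UNIV. actL A (bas h1) i k * actV A (bas h2) j k) (coproduct A h)
     = actV A (lin_ext scale (\<lambda>(k, l). mul A (antipode A (bas k)) (bas l)) (coproduct A h)) j i"
    by (simp add: lin_ext_def linD[OF l] case_prod_unfold)
  thus ?thesis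
    unfolding antipode_convolution by (cases i; cases j) (simp_all add: actV_simps)
qed

lemma evaluation_comodule_morphism:
  "(\<Sum>k\<in>UNIV. mul A (coactL A i k) (coactV A j k)) = (if i = j then 1 else 0)"
proof -
  have "antipode A (- mul A gP_inv (mul A pP gP)) = mul A gP_inv pP"
    by (simp add: antipode_simps antipode_g_inv linD[OF antipode_simps(1)] mul_assoc lin_simps g_relations(3) del: One_nat_def)
  hence "inv (antipode A) (mul A gP_inv pP) = - mul A gP_inv (mul A pP gP)"
    using inv_f_f[OF bij_is_inj[OF bij_antipode]] by metis
  moreover have "inv (antipode A) 1 = 1"
    using inv_f_f[OF bij_is_inj[OF bij_antipode], of A 1] by (simp add: antipode_simps)
  ultimately show ?thesis
    by (cases i; cases j) (simp_all add: sum_ix coactL_def coactV_def inv_antipode lin_simps mul_assoc g_relations(2) del: One_nat_def)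
qed

lemma braid_dual: "braidL A i j l k = braidV A k l j i"
  by (simp add: braidL_def braidV_def actL_def coactL_def surj_f_inv_f[OF bij_is_surj[OF bij_antipode]])

subsection \<open>The pairing descends to 2-forms\<close>

lemma braidL_eta_xi:
  "braidL A Eta Xi Xi Xi = 0" "braidL A Eta Xi Eta Xi = 0"
  "braidL A Eta Xi Xi Eta = 1" "braidL A Eta Xi Eta Eta = - (\<i> * A)"
  by (simp_all add: braidL_def actL_def coactL_def coactV_def inv_antipode antipode_simps
        linD[OF antipode_simps(1)] actV_simps)

lemma bivector_eta_xi:
  "bivector A eta_xi f Xi Xi = 0" "bivector A eta_xi f Xi Eta = - f"
  "bivector A eta_xi f Eta Xi = f" "bivector A eta_xi f Eta Eta = scale (\<i> * A) f"
  by (simp_all add: bivector_def sum_ix eta_xi_def braidL_eta_xi)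

lemma coproduct2_g: "coproduct2 A (mon n 0) = bas (((n, 0), (n, 0)), (n, 0))"
  by (simp add: coproduct2_def coproduct_mon_g)
     (simp add: mon_def tensor_bas lin_ext_bas vs_scale flip: coproduct_mon_g[unfolded mon_def tensor_bas], simp add: coproduct_mon_g[unfolded mon_def tensor_bas] tensor_bas)

lemma lin_coproduct2: "lin scale scale (coproduct2 A)"
  unfolding coproduct2_def by (rule lin_comp[OF coproduct_simps(1) lin_lin_ext[OF vs_scale]])

lemma actV_g: "actV A (mon n 0) = matr 1 0 (of_int n * (\<i> * A)) 1"
proof (induction n rule: int_induct[where k=0])
  case base show ?case using actV_simps(1) by (simp add: one_mon)
next
  case (step1 i)
  have "actV A (mul A gP (mon i 0)) k l = matr 1 0 (of_int (i + 1) * (\<i> * A)) 1 k l" for k l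
    by (cases k; cases l) (simp_all add: actV_simps step1.IH algebra_simps)
  thus ?case by (intro ext) (simp add: g_relations add.commute)
next
  case (step2 i)
  have "actV A (mul A gP_inv (mon i 0)) k l = matr 1 0 (of_int (i - 1) * (\<i> * A)) 1 k l" for k l
    by (cases k; cases l) (simp_all add: actV_simps step2.IH algebra_simps)
  thus ?case by (intro ext) (simp add: g_relations)
qed

definition pr where
  "pr A k j l i t f = lin_ext scale (\<lambda>((h1, h2), h3).
       scale (actV A (bas h1) k j * actV A (bas h2) l i) (mul A (bas h3) t)) (coproduct2 A f)"

lemma lin_pr: "lin scale scale (pr A k j l i t)"
  unfolding pr_def by (rule lin_comp[OF lin_coproduct2 lin_lin_ext[OF vs_scale]])

lemma pr_g: "pr A k j l i t (mon n 0) = scale (actV A (mon n 0) k j * actV A (mon n 0) l i) (mul A (mon n 0) t)"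
  by (simp add: pr_def coproduct2_g lin_ext_bas vs_scale bas_mon)

lemma of_g_bas: "of_g (bas n) = mon n 0" by (simp add: of_g_def lin_ext_bas vs_scale)
lemma lin_of_g: "lin scale scale of_g" unfolding of_g_def by (rule lin_lin_ext[OF vs_scale])

lemma pair_rep_formula:
  "pair_rep A (bivector A eta_xi (of_g \<pi>)) \<tau> =
     mul A (of_g \<pi>) (\<tau> Xi Eta - \<tau> Eta Xi + scale (\<i> * A) (\<tau> Eta Eta))" (is "?l \<pi> = ?r \<pi>")
proof -
  have l: "?l \<pi> = (\<Sum>k\<in>UNIV. \<Sum>l\<in>UNIV. pr A k Xi l Eta (\<tau> k l) (of_g \<pi>)
         - pr A k Eta l Xi (\<tau> k l) (of_g \<pi>) + scale (\<i> * A) (pr A k Eta l Eta (\<tau> k l) (of_g \<pi>)))" for \<pi>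
    unfolding pair_rep_def pr_def[symmetric]
    by (simp add: sum_ix bivector_eta_xi linD[OF lin_pr] algebra_simps)
  have "lin scale scale ?l"
    unfolding l sum_ix
    by (intro lin_add lin_diff lin_scale lin_comp[OF lin_of_g lin_pr])
  moreover have "lin scale scale ?r" by (rule lin_comp[OF lin_of_g lin_mul_left])
  moreover have "?l (bas n) = ?r (bas n)" for n
    unfolding l
    by (simp add: sum_ix of_g_bas pr_g actV_g lin_simps sc.scale_left_distrib algebra_simps)
  ultimately show ?thesis by (rule lin_eqI)
qed

text \<open>
  This is the span of \<open>\<xi> \<otimes> \<xi>\<close>, \<open>\<eta> \<otimes> \<xi> + \<xi> \<otimes> \<eta>\<close>, \<open>\<eta> \<otimes> \<eta> - \<ii>A \<xi> \<otimes> \<eta>\<close> over \<open>P\<close>, so the relations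
  of the exterior algebra are \<open>\<xi> \<and> \<xi> = 0\<close>, \<open>\<eta> \<and> \<xi> = - \<xi> \<and> \<eta>\<close>, \<open>\<eta> \<and> \<eta> = \<ii>A \<xi> \<and> \<eta>\<close>.
\<close>

lemma sym_forms_iff: "\<tau> \<in> sym_forms A \<longleftrightarrow> \<tau> Xi Eta - \<tau> Eta Xi + scale (\<i> * A) (\<tau> Eta Eta) = 0"
  unfolding sym_forms_def all_ix sum_ix
  by (auto simp: braidV_def coactV_def actV_simps power2_eq_square algebra_simps simp del: One_nat_def)

lemma pairing_formula:
  "pairing A (bivector A eta_xi (of_g \<pi>)) (wedge A \<omega> \<omega>') = pair_rep A (bivector A eta_xi (of_g \<pi>)) (tensor_forms A \<omega> \<omega>')"
proof -
  let ?T = "tensor_forms A \<omega> \<omega>'"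
  have "?T \<in> wedge A \<omega> \<omega>'" by (simp add: wedge_def sym_forms_def)
  moreover have "pair_rep A (bivector A eta_xi (of_g \<pi>)) \<tau> = pair_rep A (bivector A eta_xi (of_g \<pi>)) ?T"
    if "\<tau> \<in> wedge A \<omega> \<omega>'" for \<tau>
  proof -
    have "(\<tau> Xi Eta - ?T Xi Eta) - (\<tau> Eta Xi - ?T Eta Xi) + scale (\<i> * A) (\<tau> Eta Eta - ?T Eta Eta) = 0"
      using that by (simp add: wedge_def sym_forms_iff)
    hence "\<tau> Xi Eta - \<tau> Eta Xi + scale (\<i> * A) (\<tau> Eta Eta) = ?T Xi Eta - ?T Eta Xi + scale (\<i> * A) (?T Eta Eta)"
      by (simp add: sc.scale_right_diff_distrib algebra_simps)
    thus ?thesis unfolding pair_rep_formula by simp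
  qed
  ultimately show ?thesis unfolding pairing_def by (rule_tac the_equality) (blast, metis)
qed

subsection \<open>The case \<open>A = 0\<close> and the classical bracket\<close>

lemma scale_mult_left: "scale c a * b = scale c (a * b :: fn)"
  by (simp add: scale_def mult_map_scale_conv_mult mult.assoc)
lemma scale_mult_right: "a * scale c b = scale c (a * b :: fn)"
  by (simp add: scale_def mult_map_scale_conv_mult mult.left_commute)
lemma lin_times: "lin scale scale (\<lambda>a::fn. a * b)" "lin scale scale ((*) (a::fn))"
  by (intro sc_linI; simp add: algebra_simps scale_mult_left scale_mult_right)+

lemma times_mon: "mon n m * mon k l = mon (n + k) (m + l)"
  by (simp add: mon_def mult_single)

lemma mul_0: "mul 0 a b = a * b"
proof -
  have p: "(mul_p 0 ^^ m) (mon k l) = mon k (m + l)" for m k l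
    by (induction m) (simp_all add: mul_p_mon)
  have 1: "mul 0 (mon n m) b = mon n m * b" for n m b
    by (rule lin_eq_monI[OF lin_mul_right lin_times(2)]) (simp add: mul_mon p times_mon)
  show ?thesis
    by (rule lin_eq_monI[OF lin_mul_left lin_times(1)]) (rule 1)
qed

lemma lin_dx: "lin scale scale (dx G)" unfolding dx_def by (rule lin_lin_ext[OF vs_scale])
lemma lin_dp: "lin scale scale dp" unfolding dp_def by (rule lin_lin_ext[OF vs_scale])
lemma dx_mon: "dx G (mon n m) = scale (- of_int n / G) (mon n m)"
  by (subst mon_def) (simp add: dx_def lin_ext_bas vs_scale)
lemma dp_mon: "dp (mon n m) = scale (of_nat m) (mon n (m - 1))"
  by (subst mon_def) (simp add: dp_def lin_ext_bas vs_scale)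

lemma eval_fn_mon: "eval_fn G (mon n m) x p = exp (- x / G) powi n * p ^ m"
proof -
  have vs: "vector_space ((*) :: complex \<Rightarrow> _)" by unfold_locales (auto simp: algebra_simps)
  show ?thesis by (simp add: eval_fn_def mon_def lin_ext_bas[OF vs])
qed

lemma lin_eval_fn: "lin scale (*) (\<lambda>f. eval_fn G f x p)"
proof -
  have vs: "vector_space ((*) :: complex \<Rightarrow> _)" by unfold_locales (auto simp: algebra_simps)
  show ?thesis unfolding eval_fn_def by (rule lin_lin_ext[OF vs])
qed

lemma eval_fn_deriv:
  assumes "G \<noteq> 0"
  shows "((\<lambda>x. eval_fn G f x p) has_field_derivative eval_fn G (dx G f) x p) (at x)"
    and "((\<lambda>p. eval_fn G f x p) has_field_derivative eval_fn G (dp f) x p) (at p)"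
proof -
  have e: "exp (- x / G) powi n = exp (of_int n * (- x / G))" for n and x :: complex
    by (simp add: exp_power_int)
  have ex: "eval_fn G f x p = (\<Sum>(n, m)\<in>Poly_Mapping.keys f. Poly_Mapping.lookup f (n, m) * (exp (of_int n * (- x / G)) * p ^ m))" for x p
    unfolding eval_fn_def lin_ext_def e by (simp add: case_prod_unfold)
  have edx: "eval_fn G (dx G f) x p = (\<Sum>(n, m)\<in>Poly_Mapping.keys f. Poly_Mapping.lookup f (n, m) * (- of_int n / G * (exp (of_int n * (- x / G)) * p ^ m)))"
    by (subst lin_expand[OF lin_comp[OF lin_dx lin_eval_fn]])
       (simp add: bas_mon dx_mon linD[OF lin_eval_fn] eval_fn_mon exp_power_int case_prod_unfold)
  have edp: "eval_fn G (dp f) x p = (\<Sum>(n, m)\<in>Poly_Mapping.keys f. Poly_Mapping.lookup f (n, m) * (of_nat m * (exp (of_int n * (- x / G)) * p ^ (m - 1))))"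
    by (subst lin_expand[OF lin_comp[OF lin_dp lin_eval_fn]])
       (simp add: bas_mon dp_mon linD[OF lin_eval_fn] eval_fn_mon exp_power_int case_prod_unfold)
  show "((\<lambda>x. eval_fn G f x p) has_field_derivative eval_fn G (dx G f) x p) (at x)"
    unfolding ex edx case_prod_unfold
    by (rule DERIV_sum) (auto intro!: derivative_eq_intros simp: assms field_simps)
  show "((\<lambda>p. eval_fn G f x p) has_field_derivative eval_fn G (dp f) x p) (at p)"
    unfolding ex edp case_prod_unfold
    by (rule DERIV_sum) (auto intro!: derivative_eq_intros simp: field_simps)
qed

lemma eval_fn_times: "eval_fn G (a * b) x p = eval_fn G a x p * eval_fn G b x p"
proof -
  have vs: "vector_space ((*) :: complex \<Rightarrow> _)" by unfold_locales (auto simp: algebra_simps)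
  have l: "lin (*) (*) (\<lambda>z. z * c)" "lin (*) (*) ((*) c)" for c :: complex
    by (auto intro!: linI vs simp: algebra_simps)
  have 1: "eval_fn G (mon n m * b) x p = eval_fn G (mon n m) x p * eval_fn G b x p" for n m
    by (rule lin_eq_monI[OF lin_comp[OF lin_times(2) lin_eval_fn] lin_comp[OF lin_eval_fn l(2)]])
       (simp add: times_mon eval_fn_mon power_int_add power_add)
  show ?thesis
    by (rule lin_eq_monI[OF lin_comp[OF lin_times(1) lin_eval_fn] lin_comp[OF lin_eval_fn l(1)]]) (rule 1)
qed

lemma eval_classical_bracket:
  assumes "G \<noteq> 0"
    and "((\<lambda>x. eval_fn G a x p) has_field_derivative ax) (at x)"
    and "((\<lambda>p. eval_fn G a x p) has_field_derivative ap) (at p)"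
    and "((\<lambda>x. eval_fn G b x p) has_field_derivative bx) (at x)"
    and "((\<lambda>p. eval_fn G b x p) has_field_derivative bp) (at p)"
  shows "eval_fn G (classical_bracket G a b) x p = (exp (- x / G) - 1) * (ax * bp - bx * ap)"
proof -
  have "eval_fn G 1 x p = 1" by (simp add: one_mon eval_fn_mon)
  moreover have "eval_fn G (dx G a) x p = ax" "eval_fn G (dp a) x p = ap"
    "eval_fn G (dx G b) x p = bx" "eval_fn G (dp b) x p = bp"
    using assms eval_fn_deriv[OF assms(1)] DERIV_unique by blast+
  ultimately show ?thesis
    by (simp add: classical_bracket_def eval_fn_times linD[OF lin_eval_fn] eval_fn_mon)
qed

end

theory Submission
  imports Defs
begin

text \<open>
  By \<open>pairing_formula\<close> and \<open>pair_rep_formula\<close> the bracket is \<open>\<pi>(g) (\<tau>\<^sub>\<xi>\<^sub>\<eta> - \<tau>\<^sub>\<eta>\<^sub>\<xi> + \<ii>A \<tau>\<^sub>\<eta>\<^sub>\<eta>)\<close>, where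
  \<open>\<tau>\<close> represents \<open>da \<and> db\<close> in \<open>V \<otimes> V \<otimes> P\<close>.  Moving the coefficients of \<open>da\<close> past the basis forms of \<open>db\<close>
  by \<open>a \<eta> = \<eta> a + \<ii>A da\<close> gives \<open>\<tau>\<^sub>i\<^sub>j = a\<^sub>i b\<^sub>j + \<ii>A (a\<^sub>i)\<^sub>j b\<^sub>\<eta>\<close>, and the stated formula results
  by substitution.

  At \<open>A = 0\<close> the calculus is the classical one: \<open>\<partial>\<^sub>\<xi> = g \<partial>/\<partial>g = -G \<partial>/\<partial>x\<close> and
  \<open>\<partial>\<^sub>\<eta> = g \<partial>/\<partial>p\<close>, so that \<open>\<pi>(g) = (g\<^sup>-\<^sup>1 - 1)/G\<close> yields exactly the classical bracket.  For the
  limit, the product and the derivatives send families of elements of \<open>P\<close> that have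
  uniformly finite support and coefficients continuous in \<open>A\<close> to families of the same kind
  (\<open>regular_family_mul\<close>, \<open>regular_family_dP\<close>).  Hence the bracket of fixed \<open>a\<close> and \<open>b\<close> is such a
  family, and its limit as \<open>A \<rightarrow> 0\<close> is its value at \<open>A = 0\<close>.
\<close>

lemma quantum_bracket_formula:
  "quantum_bracket A (Pi_field A \<pi>) a b =
     mul A (of_g \<pi>)
      (mul A (d_xi A a) (d_eta A b) - mul A (d_eta A a) (d_xi A b)
       + scale (\<i> * A)
          (mul A (d_eta A a) (d_eta A b) + mul A (d_eta A (d_xi A a)) (d_eta A b)
           - mul A (d_xi A (d_eta A a)) (d_eta A b))
       + scale ((\<i> * A)\<^sup>2) (mul A (d_eta A (d_eta A a)) (d_eta A b)))"
  unfolding quantum_bracket_def Pi_field_def pairing_formula pair_rep_formula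
    tensor_forms_def left_mul_def
  by (rule arg_cong[where f = "mul A (of_g \<pi>)"])
     (simp add: sc.scale_right_distrib sc.scale_right_diff_distrib power2_eq_square)

lemma dP_mon_g: "dP A (mon n 0) Xi = scale (of_int n) (mon n 0)" "dP A (mon n 0) Eta = 0"
proof -
  have "dP A (mon n 0) Xi = scale (of_int n) (mon n 0) \<and> dP A (mon n 0) Eta = 0"
  proof (induction n rule: int_induct[where k=0])
    case base
    show ?case using dP_1[of A] by (simp add: one_mon)
  next
    case (step1 i)
    have e: "mon (i + 1) 0 = mul A gP (mon i 0)" by (simp add: g_relations add.commute)
    show ?case
      unfolding e by (simp add: dP_mul dP_gens step1.IH lin_simps sc.scale_left_distrib add.commute)
  next
    case (step2 i)
    have e: "mon (i - 1) 0 = mul A gP_inv (mon i 0)" by (simp add: g_relations)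
    show ?case
      unfolding e by (simp add: dP_mul dP_ginv step2.IH lin_simps sc.scale_left_diff_distrib)
  qed
  then show "dP A (mon n 0) Xi = scale (of_int n) (mon n 0)" "dP A (mon n 0) Eta = 0" by auto
qed

lemma dP_mon:
  "dP A (mon n m) i = mul A (dP A (mon n 0) i) (mon 0 m) + mul A (mon n 0) (dP A (mon 0 m) i)
     + scale (\<i> * A) (mul A (dP A (mon n 0) i) (dP A (mon 0 m) Eta))"
  using dP_mul[of A "mon n 0" "mon 0 m" i] by (simp only: normal_order)

lemma dP_mon_p_Suc:
  "dP A (mon 0 (Suc m)) i = mul A (dP A pP i) (mon 0 m) + mul A pP (dP A (mon 0 m) i)
     + scale (\<i> * A) (mul A (dP A pP i) (dP A (mon 0 m) Eta))"
  using dP_mul[of A pP "mon 0 m" i] by (simp only: p_powers)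

lemma dP_0_mon_p: "dP 0 (mon 0 m) Xi = 0" "dP 0 (mon 0 m) Eta = scale (of_nat m) (mon 1 (m - 1))"
proof -
  have "dP 0 (mon 0 m) Xi = 0 \<and> dP 0 (mon 0 m) Eta = scale (of_nat m) (mon 1 (m - 1))"
  proof (induction m)
    case 0
    show ?case by (simp add: dP_mon_g)
  next
    case (Suc m)
    have "scale (of_nat m) (mon 1 (1 + (m - 1))) = scale (of_nat m) (mon 1 m)"
      by (cases m) simp_all
    then show ?case
      by (simp add: dP_mon_p_Suc dP_gens Suc.IH mul_0 times_mon scale_mult_right sc.scale_left_distrib
          del: One_nat_def)
  qed
  then show "dP 0 (mon 0 m) Xi = 0" "dP 0 (mon 0 m) Eta = scale (of_nat m) (mon 1 (m - 1))" by auto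
qed

lemma d_xi_0:
  assumes "G \<noteq> 0"
  shows "d_xi 0 a = scale (- G) (dx G a)"
  by (rule lin_eq_monI[OF lin_dP lin_scale[OF lin_dx]])
     (subst dP_mon, simp add: dP_mon_g dP_0_mon_p dx_mon mul_0 times_mon scale_mult_left assms)

lemma d_eta_0: "d_eta 0 a = gP * dp a"
  by (rule lin_eq_monI[OF lin_dP lin_comp[OF lin_dp lin_times(2)]])
     (subst dP_mon, simp add: dP_mon_g dP_0_mon_p dp_mon mul_0 times_mon scale_mult_right add.commute)

lemma quantum_bracket_0:
  assumes "G \<noteq> 0"
  shows "quantum_bracket 0 (Pi_field 0 (scale (1 / G) (bas (-1) - bas 0))) a b = classical_bracket G a b"
proof -
  have pi: "of_g (scale (1 / G) (bas (-1) - bas 0)) = scale (1 / G) (gP_inv - 1)"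
    by (simp only: linD[OF lin_of_g] of_g_bas one_mon)
  have g: "gP * gP_inv = 1" by (simp add: times_mon one_mon)
  have "quantum_bracket 0 (Pi_field 0 (scale (1 / G) (bas (-1) - bas 0))) a b =
      scale (1 / G) (gP_inv - 1) * (scale (- G) (dx G a) * (gP * dp b) - gP * dp a * scale (- G) (dx G b))"
    unfolding quantum_bracket_formula pi mul_0 d_xi_0[OF assms] d_eta_0 by simp
  also have "\<dots> = (gP_inv - 1) * (gP * dp a * dx G b - dx G a * (gP * dp b))"
    by (simp add: scale_mult_left scale_mult_right assms flip: sc.scale_right_diff_distrib)
  also have "\<dots> = (gP_inv * gP - gP) * (dx G b * dp a - dx G a * dp b)"
    by (simp add: algebra_simps)
  also have "\<dots> = classical_bracket G a b"
    by (simp add: g classical_bracket_def algebra_simps)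
  finally show ?thesis .
qed

text \<open>
  A family of vectors \<open>F t\<close> with coefficients depending continuously on \<open>t\<close> and
  vanishing outside a finite set of indices that serves for all \<open>t\<close>.
\<close>

definition regular_family :: "('t::topological_space \<Rightarrow> ('k \<Rightarrow>\<^sub>0 complex)) \<Rightarrow> bool" where
  "regular_family F \<longleftrightarrow> (\<exists>K. finite K \<and> (\<forall>t. Poly_Mapping.keys (F t) \<subseteq> K))
     \<and> (\<forall>k. continuous_on UNIV (\<lambda>t. Poly_Mapping.lookup (F t) k))"

lemma regular_family_const: "regular_family (\<lambda>t. f)"
  unfolding regular_family_def by (auto intro: exI[of _ "Poly_Mapping.keys f"])

lemma regular_family_add:
  assumes "regular_family F" "regular_family H"
  shows "regular_family (\<lambda>t. F t + H t)"
proof -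
  obtain K K' where "finite K" "\<And>t. Poly_Mapping.keys (F t) \<subseteq> K"
    "finite K'" "\<And>t. Poly_Mapping.keys (H t) \<subseteq> K'"
    using assms unfolding regular_family_def by blast
  then have "finite (K \<union> K')" "Poly_Mapping.keys (F t + H t) \<subseteq> K \<union> K'" for t
    using Poly_Mapping.keys_add[of "F t" "H t"] by blast+
  then show ?thesis
    using assms unfolding regular_family_def
    by (auto simp: lookup_add intro!: continuous_on_add exI[of _ "K \<union> K'"])
qed

lemma regular_family_scale:
  assumes "continuous_on UNIV c" "regular_family F"
  shows "regular_family (\<lambda>t. scale (c t) (F t))"
proof -
  obtain K where "finite K" "\<And>t. Poly_Mapping.keys (F t) \<subseteq> K"
    using assms unfolding regular_family_def by blast
  moreover from this have "Poly_Mapping.keys (scale (c t) (F t)) \<subseteq> K" for t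
    by (fastforce simp: in_keys_iff)
  ultimately show ?thesis
    using assms unfolding regular_family_def by (auto intro!: continuous_on_mult)
qed

lemma regular_family_diff:
  assumes "regular_family F" "regular_family H"
  shows "regular_family (\<lambda>t. F t - H t)"
  using regular_family_add[OF assms(1) regular_family_scale[OF continuous_on_const[of _ "- 1"] assms(2)]]
  by (simp add: sc.scale_minus_left)

lemma regular_family_sum:
  assumes "\<And>i. i \<in> I \<Longrightarrow> regular_family (F i)"
  shows "regular_family (\<lambda>t. \<Sum>i\<in>I. F i t)"
  using assms
  by (induction I rule: infinite_finite_induct)
     (simp_all add: regular_family_const regular_family_add)

text \<open>
  A common finite support of the \<open>F t\<close> turns \<open>T t (F t)\<close> into a finite sum over a fixed index set, so
  that it suffices to know the family of linear maps \<open>T t\<close> on the basis.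
\<close>

lemma regular_family_lin:
  fixes F :: "'t::topological_space \<Rightarrow> fn"
  assumes "\<And>t. lin scale scale (T t)" "\<And>n m. regular_family (\<lambda>t. T t (mon n m))" "regular_family F"
  shows "regular_family (\<lambda>t. T t (F t))"
proof -
  obtain K where K: "finite K" "\<And>t. Poly_Mapping.keys (F t) \<subseteq> K"
    using assms(3) unfolding regular_family_def by blast
  have "T t (F t) = (\<Sum>k\<in>K. scale (Poly_Mapping.lookup (F t) k) (T t (bas k)))" for t
  proof -
    have "T t (F t) = lin_ext scale (\<lambda>k. T t (bas k)) (F t)"
      unfolding lin_ext_def by (rule lin_expand[OF assms(1)])
    then show ?thesis using lin_ext_superset[OF vs_scale K] by simp
  qed
  moreover have "regular_family (\<lambda>t. \<Sum>k\<in>K. scale (Poly_Mapping.lookup (F t) k) (T t (bas k)))"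
    using assms(2,3)
    by (intro regular_family_sum regular_family_scale) (auto simp: regular_family_def bas_mon)
  ultimately show ?thesis by simp
qed

lemma regular_family_mul:
  assumes "regular_family F" "regular_family H"
  shows "regular_family (\<lambda>A. mul A (F A) (H A))"
proof (rule regular_family_lin[OF lin_mul_left _ assms(1)])
  have p: "regular_family (\<lambda>A. mul_p A (F A))" if "regular_family F" for F
    by (rule regular_family_lin[OF lin_mul_p _ that])
       (auto simp: mul_p_mon intro!: regular_family_add regular_family_scale regular_family_const continuous_intros)
  have pow: "regular_family (\<lambda>A. (mul_p A ^^ m) (H A))" for m
    by (induction m) (simp_all add: assms(2) p)
  show "regular_family (\<lambda>A. mul A (mon n m) (H A))" for n m
    unfolding mul_mon by (rule regular_family_lin[OF lin_mul_g _ pow]) (simp add: regular_family_const)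
qed

lemma regular_family_dP:
  assumes "regular_family F"
  shows "regular_family (\<lambda>A. dP A (F A) i)"
proof (rule regular_family_lin[OF lin_dP _ assms])
  note intros = regular_family_add regular_family_scale regular_family_mul regular_family_const
    continuous_intros
  have g: "regular_family (\<lambda>A. dP A (mon n 0) i)" for n i
    by (cases i) (simp_all add: dP_mon_g regular_family_const)
  have gen: "regular_family (\<lambda>A. dP A pP i)" for i
    by (cases i) (auto simp: dP_gens simp del: One_nat_def intro!: intros)
  have p: "regular_family (\<lambda>A. dP A (mon 0 m) i)" for m i
  proof (induction m arbitrary: i)
    case 0
    show ?case by (rule g)
  next
    case (Suc m)
    show ?case unfolding dP_mon_p_Suc by (intro intros Suc gen)
  qed
  show "regular_family (\<lambda>A. dP A (mon n m) i)" for n m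
    unfolding dP_mon[of _ n m] by (intro intros g p)
qed

lemma regular_family_quantum_bracket:
  "regular_family (\<lambda>A. quantum_bracket A (Pi_field A \<pi>) a b)"
  unfolding quantum_bracket_formula
  by (intro regular_family_add regular_family_diff regular_family_scale regular_family_mul
    regular_family_dP regular_family_const continuous_intros)

theorem proposition4p7:
  fixes G :: complex
  assumes "G \<noteq> 0"
  shows
    "(\<forall>(hbar::complex) (\<pi> :: int \<Rightarrow>\<^sub>0 complex) (a::fn) (b::fn).
        let A = hbar / G in
        quantum_bracket A (Pi_field A \<pi>) a b =
          mul A (of_g \<pi>)
           (mul A (d_xi A a) (d_eta A b) - mul A (d_eta A a) (d_xi A b)
            + scale (\<i> * A)
               (mul A (d_eta A a) (d_eta A b) + mul A (d_eta A (d_xi A a)) (d_eta A b)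
                - mul A (d_xi A (d_eta A a)) (d_eta A b))
            + scale ((\<i> * A)\<^sup>2) (mul A (d_eta A (d_eta A a)) (d_eta A b))))
     \<and> (\<forall>(a::fn) (b::fn).
        let \<pi>\<^sub>0 = scale (1 / G) (bas (-1) - bas 0) in
        quantum_bracket 0 (Pi_field 0 \<pi>\<^sub>0) a b = classical_bracket G a b
        \<and> (\<exists>K. finite K \<and> (\<forall>hbar::complex.
              Poly_Mapping.keys (quantum_bracket (hbar / G) (Pi_field (hbar / G) \<pi>\<^sub>0) a b) \<subseteq> K))
        \<and> (\<forall>k. ((\<lambda>hbar::complex. Poly_Mapping.lookup
                   (quantum_bracket (hbar / G) (Pi_field (hbar / G) \<pi>\<^sub>0) a b) k)
                  \<longlongrightarrow> Poly_Mapping.lookup (classical_bracket G a b) k) (at 0)))"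
proof -
  define \<pi>\<^sub>0 :: "int \<Rightarrow>\<^sub>0 complex" where "\<pi>\<^sub>0 = scale (1 / G) (bas (-1) - bas 0)"
  define B where "B A a b = quantum_bracket A (Pi_field A \<pi>\<^sub>0) a b" for A a b
  have B0: "B 0 a b = classical_bracket G a b" for a b
    unfolding B_def \<pi>\<^sub>0_def by (rule quantum_bracket_0[OF assms])
  have reg: "regular_family (\<lambda>A. B A a b)" for a b
    unfolding B_def by (rule regular_family_quantum_bracket)
  have supp: "\<exists>K. finite K \<and> (\<forall>hbar. Poly_Mapping.keys (B (hbar / G) a b) \<subseteq> K)" for a b
    using reg[of a b] unfolding regular_family_def by blast
  have lim: "((\<lambda>hbar. Poly_Mapping.lookup (B (hbar / G) a b) k)
      \<longlongrightarrow> Poly_Mapping.lookup (classical_bracket G a b) k) (at 0)" for a b k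
  proof -
    have "isCont (\<lambda>A. Poly_Mapping.lookup (B A a b) k) 0"
      using reg[of a b] unfolding regular_family_def by (metis UNIV_I open_UNIV continuous_on_eq_continuous_at)
    moreover have "((\<lambda>hbar. hbar / G) \<longlongrightarrow> 0) (at 0)"
      by (auto intro!: tendsto_eq_intros simp: assms)
    ultimately show ?thesis unfolding B0[symmetric] by (rule isCont_tendsto_compose)
  qed
  show ?thesis
    unfolding Let_def \<pi>\<^sub>0_def[symmetric] B_def[symmetric]
    by (intro conjI allI quantum_bracket_formula B0 supp lim)
qed

end
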